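(* Let $A\in\mathcal{V}$ and $\theta\in Con(A)$. Then $\theta$ has $CBLP$ if and only if $\rho(\theta)$ has $CBLP$.
   Context: $\mathcal{V}$ is a congruence modular, semidegenerate variety (no nontrivial algebra has a one-element subalgebra; equivalently $\nabla_B$ is compact for all $B\in\mathcal{V}$) of finite signature. For $B\in\mathcal{V}$: $Con(B)$ is its congruence lattice with bounds $\Delta_B,\nabla_B$, $[\cdot,\cdot]$ the Freese–McKenzie commutator, $K(B)$ the compact congruences. A congruence $\phi\neq\nabla_B$ is prime if $[\alpha,\beta]\subseteq\phi$ implies $\alpha\subseteq\phi$ or $\beta\subseteq\phi$; $\rho(\theta)$ is the intersection of all prime congruences containing $\theta$. $B(Con(B))$ is the Boolean algebra of complemented elements of $Con(B)$. When $K(B)$ is closed under the commutator, the reticulation $L(B)=K(B)/{\equiv}$ ($\alpha\equiv\beta$ iff $\rho(\alpha)=\rho(\beta)$) is a bounded distributive lattice with canonical map $\lambda_B$, which maps $B(Con(B))$ injectively into the Boolean center $B(L(B))$; the reticulation of $B$ preserves the Boolean center if this map $B(Con(B))\to B(L(B))$ is surjective. Standing assumption: for every $B\in\mathcal{V}$, $K(B)$ is closed under the commutator and the reticulation of $B$ preserves the Boolean center. For $\theta\in Con(A)$, congruences of $A/\theta$ are exactly $\chi/\theta$ with $\chi\supseteq\theta$. The congruence $\theta$ has the Congruence Boolean Lifting Property ($CBLP$) if for every $\beta\in B(Con(A/\theta))$ there exists $\alpha\in B(Con(A))$ with $(\alpha\vee\theta)/\theta=\beta$. *)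

theory Defs
  imports Main
begin

text \<open>A signature is given by a type of operation symbols 'f together with an
arity function ar. An algebra is a (nonempty) carrier set with an interpretation
of every operation symbol on lists of arguments (only lists of the right length
matter).\<close>

record ('a, 'f) alg =
  carrier :: "'a set"
  ops :: "'f \<Rightarrow> 'a list \<Rightarrow> 'a"

definition algebra :: "('f \<Rightarrow> nat) \<Rightarrow> ('a, 'f) alg \<Rightarrow> bool" where
  "algebra ar B \<longleftrightarrow> carrier B \<noteq> {} \<and>
     (\<forall>f xs. length xs = ar f \<and> set xs \<subseteq> carrier B \<longrightarrow> ops B f xs \<in> carrier B)"

datatype ('f, 'v) "term" = Var 'v | App 'f "('f, 'v) term list"

fun wf_term :: "('f \<Rightarrow> nat) \<Rightarrow> ('f, 'v) term \<Rightarrow> bool" where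
  "wf_term ar (Var x) = True"
| "wf_term ar (App f ts) = (length ts = ar f \<and> (\<forall>t\<in>set ts. wf_term ar t))"

fun eval :: "('a, 'f) alg \<Rightarrow> ('v \<Rightarrow> 'a) \<Rightarrow> ('f, 'v) term \<Rightarrow> 'a" where
  "eval B v (Var x) = v x"
| "eval B v (App f ts) = ops B f (map (eval B v) ts)"

text \<open>The variety V is the equational class Mod(Eqs) of a set of (well-formed) identities.\<close>

definition inV :: "('f \<Rightarrow> nat) \<Rightarrow> (('f, nat) term \<times> ('f, nat) term) set \<Rightarrow> ('a, 'f) alg \<Rightarrow> bool" where
  "inV ar Eqs B \<longleftrightarrow> algebra ar B \<and>
     (\<forall>(s, t)\<in>Eqs. \<forall>v. range v \<subseteq> carrier B \<longrightarrow> eval B v s = eval B v t)"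

definition Con :: "('f \<Rightarrow> nat) \<Rightarrow> ('a, 'f) alg \<Rightarrow> ('a \<times> 'a) set set" where
  "Con ar B = {\<theta>. equiv (carrier B) \<theta> \<and>
     (\<forall>f xs ys. length xs = ar f \<and> length ys = ar f \<and> list_all2 (\<lambda>x y. (x, y) \<in> \<theta>) xs ys
        \<longrightarrow> (ops B f xs, ops B f ys) \<in> \<theta>)}"

definition Delta :: "('a, 'f) alg \<Rightarrow> ('a \<times> 'a) set" where
  "Delta B = Id_on (carrier B)"

definition Nabla :: "('a, 'f) alg \<Rightarrow> ('a \<times> 'a) set" where
  "Nabla B = carrier B \<times> carrier B"

definition Cg :: "('f \<Rightarrow> nat) \<Rightarrow> ('a, 'f) alg \<Rightarrow> ('a \<times> 'a) set \<Rightarrow> ('a \<times> 'a) set" where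
  "Cg ar B R = Nabla B \<inter> \<Inter>{\<theta> \<in> Con ar B. R \<subseteq> \<theta>}"

definition Join :: "('f \<Rightarrow> nat) \<Rightarrow> ('a, 'f) alg \<Rightarrow> ('a \<times> 'a) set set \<Rightarrow> ('a \<times> 'a) set" where
  "Join ar B S = Cg ar B (\<Union>S)"

definition join :: "('f \<Rightarrow> nat) \<Rightarrow> ('a, 'f) alg \<Rightarrow> ('a \<times> 'a) set \<Rightarrow> ('a \<times> 'a) set \<Rightarrow> ('a \<times> 'a) set" where
  "join ar B \<alpha> \<beta> = Join ar B {\<alpha>, \<beta>}"

definition modular_Con :: "('f \<Rightarrow> nat) \<Rightarrow> ('a, 'f) alg \<Rightarrow> bool" where
  "modular_Con ar B \<longleftrightarrow> (\<forall>\<alpha>\<in>Con ar B. \<forall>\<beta>\<in>Con ar B. \<forall>\<gamma>\<in>Con ar B.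
      \<alpha> \<subseteq> \<gamma> \<longrightarrow> join ar B \<alpha> (\<beta> \<inter> \<gamma>) = join ar B \<alpha> \<beta> \<inter> \<gamma>)"

definition K :: "('f \<Rightarrow> nat) \<Rightarrow> ('a, 'f) alg \<Rightarrow> ('a \<times> 'a) set set" where
  "K ar B = {\<alpha> \<in> Con ar B. \<forall>S. S \<subseteq> Con ar B \<and> \<alpha> \<subseteq> Join ar B S
      \<longrightarrow> (\<exists>T \<subseteq> S. finite T \<and> \<alpha> \<subseteq> Join ar B T)}"

definition BoolCon :: "('f \<Rightarrow> nat) \<Rightarrow> ('a, 'f) alg \<Rightarrow> ('a \<times> 'a) set set" where
  "BoolCon ar B = {\<alpha> \<in> Con ar B. \<exists>\<beta>\<in>Con ar B. \<alpha> \<inter> \<beta> = Delta B \<and> join ar B \<alpha> \<beta> = Nabla B}"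

text \<open>Term condition: alpha centralizes beta modulo delta. Term variables Inl i are the
alpha-variables, Inr j the beta-variables.\<close>

definition centralizes :: "('f \<Rightarrow> nat) \<Rightarrow> ('a, 'f) alg \<Rightarrow> ('a \<times> 'a) set \<Rightarrow> ('a \<times> 'a) set
    \<Rightarrow> ('a \<times> 'a) set \<Rightarrow> bool" where
  "centralizes ar B \<alpha> \<beta> \<delta> \<longleftrightarrow>
     (\<forall>(t :: ('f, nat + nat) term) a b c d. wf_term ar t \<longrightarrow>
        (\<forall>i. (a i, b i) \<in> \<alpha>) \<longrightarrow> (\<forall>j. (c j, d j) \<in> \<beta>) \<longrightarrow>
        (eval B (case_sum a c) t, eval B (case_sum a d) t) \<in> \<delta> \<longrightarrow>
        (eval B (case_sum b c) t, eval B (case_sum b d) t) \<in> \<delta>)"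

definition comm :: "('f \<Rightarrow> nat) \<Rightarrow> ('a, 'f) alg \<Rightarrow> ('a \<times> 'a) set \<Rightarrow> ('a \<times> 'a) set \<Rightarrow> ('a \<times> 'a) set" where
  "comm ar B \<alpha> \<beta> = Nabla B \<inter> \<Inter>{\<delta> \<in> Con ar B. centralizes ar B \<alpha> \<beta> \<delta>}"

definition prime_con :: "('f \<Rightarrow> nat) \<Rightarrow> ('a, 'f) alg \<Rightarrow> ('a \<times> 'a) set \<Rightarrow> bool" where
  "prime_con ar B \<phi> \<longleftrightarrow> \<phi> \<in> Con ar B \<and> \<phi> \<noteq> Nabla B \<and>
     (\<forall>\<alpha>\<in>Con ar B. \<forall>\<beta>\<in>Con ar B. comm ar B \<alpha> \<beta> \<subseteq> \<phi> \<longrightarrow> \<alpha> \<subseteq> \<phi> \<or> \<beta> \<subseteq> \<phi>)"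

text \<open>rho(theta): intersection of all prime congruences containing theta (empty intersection = Nabla).\<close>

definition rho :: "('f \<Rightarrow> nat) \<Rightarrow> ('a, 'f) alg \<Rightarrow> ('a \<times> 'a) set \<Rightarrow> ('a \<times> 'a) set" where
  "rho ar B \<theta> = Nabla B \<inter> \<Inter>{\<phi>. prime_con ar B \<phi> \<and> \<theta> \<subseteq> \<phi>}"

definition K_comm_closed :: "('f \<Rightarrow> nat) \<Rightarrow> ('a, 'f) alg \<Rightarrow> bool" where
  "K_comm_closed ar B \<longleftrightarrow> (\<forall>\<alpha>\<in>K ar B. \<forall>\<beta>\<in>K ar B. comm ar B \<alpha> \<beta> \<in> K ar B)"

text \<open>The reticulation L(B) = K(B)/\<equiv>, where alpha \<equiv> beta iff rho(alpha) = rho(beta), with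
lambda_B(alpha) the class of alpha, lattice operations lambda(alpha) \<and> lambda(beta) = lambda([alpha,beta]),
lambda(alpha) \<or> lambda(beta) = lambda(alpha \<or> beta), bottom lambda(Delta), top lambda(Nabla).
The class lambda(alpha) is in the Boolean center B(L(B)) iff it has a complement in L(B);
the reticulation preserves the Boolean center iff every element of B(L(B)) is lambda(gamma)
for some gamma in B(Con(B)). Both are written out on representatives.\<close>

definition ret_bool :: "('f \<Rightarrow> nat) \<Rightarrow> ('a, 'f) alg \<Rightarrow> ('a \<times> 'a) set \<Rightarrow> bool" where
  "ret_bool ar B \<alpha> \<longleftrightarrow> \<alpha> \<in> K ar B \<and>
     (\<exists>\<beta>\<in>K ar B. rho ar B (comm ar B \<alpha> \<beta>) = rho ar B (Delta B)
                \<and> rho ar B (join ar B \<alpha> \<beta>) = rho ar B (Nabla B))"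

definition ret_preserves_bool :: "('f \<Rightarrow> nat) \<Rightarrow> ('a, 'f) alg \<Rightarrow> bool" where
  "ret_preserves_bool ar B \<longleftrightarrow>
     (\<forall>\<alpha>. ret_bool ar B \<alpha> \<longrightarrow> (\<exists>\<gamma>\<in>BoolCon ar B. rho ar B \<gamma> = rho ar B \<alpha>))"

definition no_trivial_subalg :: "('f \<Rightarrow> nat) \<Rightarrow> ('a, 'f) alg \<Rightarrow> bool" where
  "no_trivial_subalg ar B \<longleftrightarrow>
     ((\<exists>x\<in>carrier B. \<exists>y\<in>carrier B. x \<noteq> y) \<longrightarrow>
        \<not> (\<exists>x\<in>carrier B. \<forall>f. ops B f (replicate (ar f) x) = x))"

definition standing :: "('f \<Rightarrow> nat) \<Rightarrow> (('f, nat) term \<times> ('f, nat) term) set \<Rightarrow> ('a, 'f) alg \<Rightarrow> bool" where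
  "standing ar Eqs B \<longleftrightarrow> (inV ar Eqs B \<longrightarrow>
     modular_Con ar B \<and> no_trivial_subalg ar B \<and> K_comm_closed ar B \<and> ret_preserves_bool ar B)"

definition quot :: "('a, 'f) alg \<Rightarrow> ('a \<times> 'a) set \<Rightarrow> ('a set, 'f) alg" where
  "quot B \<theta> = \<lparr>carrier = carrier B // \<theta>,
               ops = (\<lambda>f Xs. \<theta> `` {ops B f (map (\<lambda>X. SOME x. x \<in> X) Xs)})\<rparr>"

definition quot_con :: "('a \<times> 'a) set \<Rightarrow> ('a \<times> 'a) set \<Rightarrow> ('a set \<times> 'a set) set" where
  "quot_con \<theta> \<chi> = {(\<theta> `` {x}, \<theta> `` {y}) | x y. (x, y) \<in> \<chi>}"

definition CBLP :: "('f \<Rightarrow> nat) \<Rightarrow> ('a, 'f) alg \<Rightarrow> ('a \<times> 'a) set \<Rightarrow> bool" where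
  "CBLP ar A \<theta> \<longleftrightarrow> (\<forall>\<beta>\<in>BoolCon ar (quot A \<theta>).
      \<exists>\<alpha>\<in>BoolCon ar A. quot_con \<theta> (join ar A \<alpha> \<theta>) = \<beta>)"

end

theory Submission
  imports Defs
begin

text \<open>
Write \<open>C(\<alpha>, \<beta>; \<delta>)\<close> for the term condition and \<open>A(\<beta>)\<close> for \<open>\<beta>\<close> as a subalgebra of \<open>A \<times> A\<close>.
The term condition says that \<open>\<delta>\<close> is saturated under the congruence of \<open>A(\<beta>)\<close> generated by the pairs
\<open>((x, x), (y, y))\<close> with \<open>(x, y) \<in> \<alpha>\<close>. Gumm's shifting lemma in \<open>A(\<beta>)\<close> then shows that
\<open>C(\<alpha>, \<beta>; \<delta>)\<close> persists for larger \<open>\<delta>\<close> and is symmetric in \<open>\<alpha>, \<beta>\<close>. For \<open>\<alpha> = \<nabla>\<close> the quotient of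
\<open>A(\<beta>)\<close> by that congruence has a one-element subalgebra, the class of the diagonal, so by
semidegeneracy \<open>C(\<nabla>, \<beta>; \<delta>)\<close> forces \<open>\<beta> \<subseteq> \<delta>\<close>. It follows that proper congruences lie below primes
and that primes of \<open>A/\<theta>\<close> correspond to primes of \<open>A\<close> above \<open>\<theta>\<close>. Moreover, if \<open>\<chi>\<close> has a complement
over some \<open>\<theta> \<subseteq> \<psi>\<close>, then \<open>\<chi> \<subseteq> \<rho>(\<psi>)\<close> already implies \<open>\<chi> \<subseteq> \<psi>\<close>: radicals determine complemented
congruences. As \<open>\<rho>(\<alpha> \<or> \<theta>) = \<rho>(\<alpha> \<or> \<rho>(\<theta>))\<close>, a lift along \<open>\<rho>(\<theta>)\<close> is a lift along \<open>\<theta>\<close>. The converse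
also needs that every congruence complemented over \<open>\<rho>(\<theta>)\<close> has the radical of one complemented over
\<open>\<theta>\<close>, which is the preservation of the Boolean center by the reticulation of \<open>A/\<theta>\<close>.
\<close>

section \<open>Congruences\<close>

lemma algebra_ops:
  "algebra ar B \<Longrightarrow> length xs = ar f \<Longrightarrow> set xs \<subseteq> carrier B \<Longrightarrow> ops B f xs \<in> carrier B"
  by (simp add: algebra_def)

lemma Con_equiv: "\<theta> \<in> Con ar B \<Longrightarrow> equiv (carrier B) \<theta>"
  by (simp add: Con_def)

lemma Con_subset_Nabla: "\<theta> \<in> Con ar B \<Longrightarrow> \<theta> \<subseteq> Nabla B"
  by (simp add: Con_def equiv_def Nabla_def)

lemma Con_carrier:
  assumes "\<theta> \<in> Con ar B" and "(x, y) \<in> \<theta>"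
  shows "x \<in> carrier B" and "y \<in> carrier B"
  using Con_subset_Nabla[OF assms(1)] assms(2) by (auto simp: Nabla_def)

lemma Con_refl: "\<theta> \<in> Con ar B \<Longrightarrow> x \<in> carrier B \<Longrightarrow> (x, x) \<in> \<theta>"
  by (simp add: Con_def equiv_def refl_on_def)

lemma Con_sym: "\<theta> \<in> Con ar B \<Longrightarrow> (x, y) \<in> \<theta> \<Longrightarrow> (y, x) \<in> \<theta>"
  by (auto simp: Con_def equiv_def dest: symD)

lemma Con_trans: "\<theta> \<in> Con ar B \<Longrightarrow> (x, y) \<in> \<theta> \<Longrightarrow> (y, z) \<in> \<theta> \<Longrightarrow> (x, z) \<in> \<theta>"
  by (auto simp: Con_def equiv_def dest: transD)

lemma Con_ops:
  "\<theta> \<in> Con ar B \<Longrightarrow> length xs = ar f \<Longrightarrow> (xs, ys) \<in> listrel \<theta> \<Longrightarrow> (ops B f xs, ops B f ys) \<in> \<theta>"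
  by (simp add: Con_def listrel_iff_nth list_all2_conv_all_nth)

lemma Con_ops_update:
  assumes \<theta>: "\<theta> \<in> Con ar B" and "length xs = ar f" and xs: "set xs \<subseteq> carrier B"
    and "i < length xs" and "(xs ! i, y) \<in> \<theta>"
  shows "(ops B f xs, ops B f (xs[i := y])) \<in> \<theta>"
proof (rule Con_ops[OF \<theta> assms(2)])
  have "(xs ! j, xs ! j) \<in> \<theta>" if "j < length xs" for j
    using Con_refl[OF \<theta>] xs that nth_mem by blast
  then show "(xs, xs[i := y]) \<in> listrel \<theta>"
    using assms(4,5) by (simp add: listrel_iff_nth nth_list_update)
qed

lemma ConI:
  assumes B: "algebra ar B" and \<theta>: "equiv (carrier B) \<theta>"
    and update: "\<And>f xs i y. length xs = ar f \<Longrightarrow> set xs \<subseteq> carrier B \<Longrightarrow> i < length xs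
      \<Longrightarrow> (xs ! i, y) \<in> \<theta> \<Longrightarrow> (ops B f xs, ops B f (xs[i := y])) \<in> \<theta>"
  shows "\<theta> \<in> Con ar B"
proof -
  have "(ops B f xs, ops B f ys) \<in> \<theta>"
    if len: "length xs = ar f" and xs: "set xs \<subseteq> carrier B" and rel: "(xs, ys) \<in> (listrel1 \<theta>)\<^sup>*"
    for f xs ys
    using rel
  proof (induction rule: rtrancl_induct)
    case base
    show ?case using \<theta> algebra_ops[OF B len xs] by (auto simp: equiv_def refl_on_def)
  next
    case (step ys zs)
    have "(xs, ys) \<in> listrel (\<theta>\<^sup>*)"
      using step.hyps(1) by (simp add: listrel_rtrancl_eq_rtrancl_listrel1)
    moreover have "y \<in> carrier B" if "(x, y) \<in> \<theta>\<^sup>*" and "x \<in> carrier B" for x y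
      using that \<theta> by (induction rule: rtrancl_induct) (auto simp: equiv_def)
    ultimately have "length ys = ar f" "set ys \<subseteq> carrier B"
      using len xs by (fastforce simp: listrel_iff_nth set_conv_nth)+
    moreover obtain i y where "(ys ! i, y) \<in> \<theta>" "i < length ys" "zs = ys[i := y]"
      using step.hyps(2) by (auto simp: listrel1_iff_update)
    ultimately have "(ops B f ys, ops B f zs) \<in> \<theta>" using update by blast
    with step.IH \<theta> show ?case by (auto simp: equiv_def dest: transD)
  qed
  moreover have "(xs, ys) \<in> (listrel1 \<theta>)\<^sup>*" "set xs \<subseteq> carrier B" if "(xs, ys) \<in> listrel \<theta>" for xs ys
    using that listrel_subset[of \<theta> "carrier B"] \<theta> rtrancl_listrel1_if_listrel
    by (auto simp: equiv_def)
  ultimately show ?thesis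
    using \<theta> unfolding Con_def listrel_iff_nth list_all2_conv_all_nth by blast
qed

lemma Nabla_in_Con: "algebra ar B \<Longrightarrow> Nabla B \<in> Con ar B"
  by (rule ConI)
    (auto simp: Nabla_def equiv_def refl_on_def sym_def trans_def intro!: algebra_ops
      dest: subsetD[OF set_update_subset_insert])

lemma Delta_in_Con: "algebra ar B \<Longrightarrow> Delta B \<in> Con ar B"
  by (rule ConI)
    (auto simp: Delta_def equiv_def refl_on_def sym_def trans_def intro!: algebra_ops)

lemma Delta_subset_Con: "\<theta> \<in> Con ar B \<Longrightarrow> Delta B \<subseteq> \<theta>"
  by (auto simp: Delta_def intro: Con_refl)

lemma Nabla_Inter_in_Con:
  assumes B: "algebra ar B" and S: "S \<subseteq> Con ar B"
  shows "Nabla B \<inter> \<Inter>S \<in> Con ar B"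
proof -
  let ?S = "insert (Nabla B) S"
  have sub: "?S \<subseteq> Con ar B" using Nabla_in_Con[OF B] S by simp
  then have equiv: "equiv (carrier B) \<phi>" if "\<phi> \<in> ?S" for \<phi> using that Con_equiv by blast
  have "\<Inter>?S \<in> Con ar B"
  proof (rule ConI[OF B equivI])
    show "\<Inter>?S \<subseteq> carrier B \<times> carrier B" by (auto simp: Nabla_def)
    show "refl_on (carrier B) (\<Inter>?S)" using equiv by (simp add: equiv_def refl_on_def)
    show "sym (\<Inter>?S)" using sym_INTER[of ?S "\<lambda>\<phi>. \<phi>"] equiv by (simp add: equiv_def)
    show "trans (\<Inter>?S)" using trans_INTER[of ?S "\<lambda>\<phi>. \<phi>"] equiv by (simp add: equiv_def)
    show "(ops B f xs, ops B f (xs[i := y])) \<in> \<Inter>?S"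
      if "length xs = ar f" "set xs \<subseteq> carrier B" "i < length xs" "(xs ! i, y) \<in> \<Inter>?S" for f xs i y
      using that sub Con_ops_update[of _ ar B xs f i y] by blast
  qed
  then show ?thesis by simp
qed

lemma Int_in_Con:
  assumes "algebra ar B" "\<alpha> \<in> Con ar B" "\<beta> \<in> Con ar B"
  shows "\<alpha> \<inter> \<beta> \<in> Con ar B"
  using Nabla_Inter_in_Con[OF assms(1), of "{\<alpha>, \<beta>}"] assms Con_subset_Nabla[OF assms(2)]
  by (simp add: inf.absorb2 le_infI1)

lemma Con_directed_Union:
  assumes B: "algebra ar B" and S: "S \<subseteq> Con ar B" "S \<noteq> {}"
    and dir: "\<And>X Y. X \<in> S \<Longrightarrow> Y \<in> S \<Longrightarrow> \<exists>Z\<in>S. X \<union> Y \<subseteq> Z"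
  shows "\<Union>S \<in> Con ar B"
proof (rule ConI[OF B equivI])
  show "\<Union>S \<subseteq> carrier B \<times> carrier B" using S Con_carrier by fast
  show "refl_on (carrier B) (\<Union>S)"
    using S Con_refl[of _ ar B] unfolding refl_on_def by blast
  show "sym (\<Union>S)"
    using sym_UNION[of S "\<lambda>\<phi>. \<phi>"] S Con_equiv[of _ ar B] by (auto simp: equiv_def)
  show "trans (\<Union>S)"
  proof (rule transI)
    fix x y z assume "(x, y) \<in> \<Union>S" "(y, z) \<in> \<Union>S"
    then obtain X Y where "X \<in> S" "(x, y) \<in> X" "Y \<in> S" "(y, z) \<in> Y" by blast
    then obtain Z where "Z \<in> S" "(x, y) \<in> Z" "(y, z) \<in> Z" using dir[of X Y] by blast
    then show "(x, z) \<in> \<Union>S" using S Con_trans[of Z ar B x y z] by blast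
  qed
  show "(ops B f xs, ops B f (xs[i := y])) \<in> \<Union>S"
    if "length xs = ar f" "set xs \<subseteq> carrier B" "i < length xs" "(xs ! i, y) \<in> \<Union>S" for f xs i y
    using that S Con_ops_update[of _ ar B xs f i y] by blast
qed

lemma Con_trancl:
  assumes B: "algebra ar B" and R: "R \<subseteq> Nabla B"
    and refl: "\<And>x. x \<in> carrier B \<Longrightarrow> (x, x) \<in> R"
    and sym: "\<And>x y. (x, y) \<in> R \<Longrightarrow> (y, x) \<in> R"
    and update: "\<And>f xs i y. length xs = ar f \<Longrightarrow> set xs \<subseteq> carrier B \<Longrightarrow> i < length xs
      \<Longrightarrow> (xs ! i, y) \<in> R \<Longrightarrow> (ops B f xs, ops B f (xs[i := y])) \<in> R"
  shows "R\<^sup>+ \<in> Con ar B"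
proof (rule ConI[OF B equivI])
  show "R\<^sup>+ \<subseteq> carrier B \<times> carrier B" using R unfolding Nabla_def by (rule trancl_subset_Sigma)
  show "refl_on (carrier B) (R\<^sup>+)" using refl by (auto simp: refl_on_def)
  show "Relation.sym (R\<^sup>+)" using sym by (intro sym_trancl symI)
  show "trans (R\<^sup>+)" by (rule trans_trancl)
  fix f xs i y
  assume xs: "length xs = ar f" "set xs \<subseteq> carrier B" "i < length xs" and "(xs ! i, y) \<in> R\<^sup>+"
  from this(4) show "(ops B f xs, ops B f (xs[i := y])) \<in> R\<^sup>+"
  proof (induction rule: trancl_induct)
    case (base y)
    then show ?case using update[OF xs] by blast
  next
    case (step y z)
    have "set (xs[i := y]) \<subseteq> carrier B"
      using set_update_subset_insert[of xs i y] xs step.hyps(2) R by (auto simp: Nabla_def)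
    then have "(ops B f (xs[i := y]), ops B f (xs[i := z])) \<in> R"
      using update[of "xs[i := y]" f i z] xs step.hyps(2) by simp
    with step.IH show ?case by simp
  qed
qed

lemma Cg_in_Con: "algebra ar B \<Longrightarrow> Cg ar B R \<in> Con ar B"
  unfolding Cg_def by (rule Nabla_Inter_in_Con) auto

lemma subset_Cg: "R \<subseteq> Nabla B \<Longrightarrow> R \<subseteq> Cg ar B R"
  unfolding Cg_def by auto

lemma Cg_least: "\<theta> \<in> Con ar B \<Longrightarrow> R \<subseteq> \<theta> \<Longrightarrow> Cg ar B R \<subseteq> \<theta>"
  unfolding Cg_def by auto

lemma Join_in_Con: "algebra ar B \<Longrightarrow> Join ar B S \<in> Con ar B"
  by (simp add: Join_def Cg_in_Con)

lemma Join_ge: "S \<subseteq> Con ar B \<Longrightarrow> \<alpha> \<in> S \<Longrightarrow> \<alpha> \<subseteq> Join ar B S"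
  unfolding Join_def using subset_Cg[of "\<Union>S" B ar] Con_subset_Nabla by blast

lemma Join_least: "\<gamma> \<in> Con ar B \<Longrightarrow> (\<And>\<alpha>. \<alpha> \<in> S \<Longrightarrow> \<alpha> \<subseteq> \<gamma>) \<Longrightarrow> Join ar B S \<subseteq> \<gamma>"
  unfolding Join_def by (intro Cg_least) auto

lemma join_in_Con: "algebra ar B \<Longrightarrow> join ar B \<alpha> \<beta> \<in> Con ar B"
  by (simp add: join_def Join_in_Con)

lemma join_ge1: "\<alpha> \<in> Con ar B \<Longrightarrow> \<beta> \<in> Con ar B \<Longrightarrow> \<alpha> \<subseteq> join ar B \<alpha> \<beta>"
  and join_ge2: "\<alpha> \<in> Con ar B \<Longrightarrow> \<beta> \<in> Con ar B \<Longrightarrow> \<beta> \<subseteq> join ar B \<alpha> \<beta>"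
  by (simp_all add: join_def Join_ge)

lemma join_least: "\<gamma> \<in> Con ar B \<Longrightarrow> \<alpha> \<subseteq> \<gamma> \<Longrightarrow> \<beta> \<subseteq> \<gamma> \<Longrightarrow> join ar B \<alpha> \<beta> \<subseteq> \<gamma>"
  unfolding join_def by (rule Join_least) auto

lemma join_eq_trancl:
  assumes B: "algebra ar B" and \<alpha>: "\<alpha> \<in> Con ar B" and \<beta>: "\<beta> \<in> Con ar B"
  shows "join ar B \<alpha> \<beta> = (\<alpha> \<union> \<beta>)\<^sup>+"
proof
  have "(\<alpha> \<union> \<beta>)\<^sup>+ \<in> Con ar B"
  proof (rule Con_trancl[OF B])
    show "\<alpha> \<union> \<beta> \<subseteq> Nabla B" using Con_subset_Nabla \<alpha> \<beta> by blast
    show "(ops B f xs, ops B f (xs[i := y])) \<in> \<alpha> \<union> \<beta>"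
      if "length xs = ar f" "set xs \<subseteq> carrier B" "i < length xs" "(xs ! i, y) \<in> \<alpha> \<union> \<beta>" for f xs i y
      using that Con_ops_update[OF \<alpha>] Con_ops_update[OF \<beta>] by blast
  qed (use Con_refl[OF \<alpha>] Con_sym[OF \<alpha>] Con_sym[OF \<beta>] in auto)
  then show "join ar B \<alpha> \<beta> \<subseteq> (\<alpha> \<union> \<beta>)\<^sup>+" by (rule join_least) auto
  have "\<alpha> \<union> \<beta> \<subseteq> join ar B \<alpha> \<beta>" using join_ge1[OF \<alpha> \<beta>] join_ge2[OF \<alpha> \<beta>] by blast
  moreover have "trans (join ar B \<alpha> \<beta>)"
    using Con_equiv[OF join_in_Con[OF B]] by (simp add: equiv_def)
  ultimately show "(\<alpha> \<union> \<beta>)\<^sup>+ \<subseteq> join ar B \<alpha> \<beta>"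
    using trancl_mono_subset[of "\<alpha> \<union> \<beta>" "join ar B \<alpha> \<beta>"] by simp
qed

lemma modular_shift:
  assumes B: "algebra ar B" "modular_Con ar B"
    and \<alpha>: "\<alpha> \<in> Con ar B" and \<psi>: "\<psi> \<in> Con ar B" and \<gamma>: "\<gamma> \<in> Con ar B"
    and "\<alpha> \<inter> \<psi> \<subseteq> \<gamma>"
    and "(x, y) \<in> \<alpha>" "(z, u) \<in> \<alpha>" "(x, z) \<in> \<psi>" "(y, u) \<in> \<psi>" "(z, u) \<in> \<gamma>"
  shows "(x, y) \<in> \<gamma>"
proof -
  let ?J = "join ar B (\<alpha> \<inter> \<gamma>) \<psi>"
  have \<alpha>\<gamma>: "\<alpha> \<inter> \<gamma> \<in> Con ar B" by (rule Int_in_Con[OF B(1) \<alpha> \<gamma>])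
  have J: "?J \<in> Con ar B" by (rule join_in_Con[OF B(1)])
  have "(x, z) \<in> ?J" "(z, u) \<in> ?J" "(u, y) \<in> ?J"
    using assms join_ge1[OF \<alpha>\<gamma> \<psi>] join_ge2[OF \<alpha>\<gamma> \<psi>] Con_sym[OF \<psi>] by blast+
  then have "(x, y) \<in> ?J \<inter> \<alpha>" using Con_trans[OF J] assms by blast
  also have "?J \<inter> \<alpha> = join ar B (\<alpha> \<inter> \<gamma>) (\<psi> \<inter> \<alpha>)"
    using B(2) \<alpha> \<psi> \<alpha>\<gamma> by (simp add: modular_Con_def)
  also have "\<dots> \<subseteq> \<gamma>" using assms by (intro join_least) auto
  finally show ?thesis .
qed

section \<open>Compact congruences\<close>

lemma Join_mono: "S \<subseteq> T \<Longrightarrow> Join ar B S \<subseteq> Join ar B T"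
  unfolding Join_def Cg_def by blast

lemma Join_eq_Union_finite:
  assumes B: "algebra ar B" and S: "S \<subseteq> Con ar B"
  shows "Join ar B S = \<Union>(Join ar B ` {T. finite T \<and> T \<subseteq> S})" (is "_ = \<Union>?D")
proof
  have "\<Union>?D \<in> Con ar B"
  proof (rule Con_directed_Union[OF B])
    show "?D \<subseteq> Con ar B" "?D \<noteq> {}" using Join_in_Con[OF B] by auto
    fix X Y assume "X \<in> ?D" "Y \<in> ?D"
    then obtain T U where "finite T" "T \<subseteq> S" "X = Join ar B T"
      "finite U" "U \<subseteq> S" "Y = Join ar B U" by auto
    then show "\<exists>Z\<in>?D. X \<union> Y \<subseteq> Z"
      using Join_mono[of T "T \<union> U" ar B] Join_mono[of U "T \<union> U" ar B]
      by (intro bexI[of _ "Join ar B (T \<union> U)"]) simp_all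
  qed
  then show "Join ar B S \<subseteq> \<Union>?D"
  proof (rule Join_least)
    fix \<alpha> assume "\<alpha> \<in> S"
    then have "\<alpha> \<subseteq> Join ar B {\<alpha>}" using S by (intro Join_ge) auto
    moreover have "Join ar B {\<alpha>} \<in> ?D" using \<open>\<alpha> \<in> S\<close> by blast
    ultimately show "\<alpha> \<subseteq> \<Union>?D" by blast
  qed
  show "\<Union>?D \<subseteq> Join ar B S" using Join_mono[of _ S ar B] by blast
qed

lemma Cg_finite_compact:
  assumes B: "algebra ar B" and R: "finite R" "R \<subseteq> Nabla B"
  shows "Cg ar B R \<in> K ar B"
proof -
  have "\<exists>T\<subseteq>S. finite T \<and> Cg ar B R \<subseteq> Join ar B T"
    if S: "S \<subseteq> Con ar B" and cover: "Cg ar B R \<subseteq> Join ar B S" for S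
  proof -
    have "R \<subseteq> Join ar B S" using subset_Cg[OF R(2)] cover by (rule order_trans)
    then have "R \<subseteq> \<Union>(Join ar B ` {T. finite T \<and> T \<subseteq> S})"
      by (simp only: Join_eq_Union_finite[OF B S])
    then obtain D where D: "finite D" "D \<subseteq> Join ar B ` {T. finite T \<and> T \<subseteq> S}" "R \<subseteq> \<Union>D"
      by (rule finite_subset_Union[OF R(1)])
    obtain \<T> where \<T>: "\<T> \<subseteq> {T. finite T \<and> T \<subseteq> S}" "finite \<T>" "D = Join ar B ` \<T>"
      using finite_subset_image[OF D(1,2)] by (elim exE conjE)
    have "\<Union>D \<subseteq> Join ar B (\<Union>\<T>)"
      unfolding \<T>(3) by (intro Union_least) (auto intro: subsetD[OF Join_mono, rotated])
    then have "Cg ar B R \<subseteq> Join ar B (\<Union>\<T>)"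
      using D(3) by (intro Cg_least Join_in_Con B) simp
    moreover have "finite (\<Union>\<T>)" "\<Union>\<T> \<subseteq> S" using \<T> by auto
    ultimately show ?thesis by (intro exI[of _ "\<Union>\<T>"]) simp
  qed
  then show ?thesis by (simp add: K_def Cg_in_Con[OF B])
qed

lemma K_in_Con: "\<alpha> \<in> K ar B \<Longrightarrow> \<alpha> \<in> Con ar B"
  by (simp add: K_def)

lemma compact_parts_of_join_Nabla:
  assumes B: "algebra ar B" and compact: "Nabla B \<in> K ar B"
    and \<alpha>: "\<alpha> \<in> Con ar B" and \<beta>: "\<beta> \<in> Con ar B" and top: "join ar B \<alpha> \<beta> = Nabla B"
  obtains \<kappa> \<kappa>' where "\<kappa> \<in> K ar B" "\<kappa>' \<in> K ar B" "\<kappa> \<subseteq> \<alpha>" "\<kappa>' \<subseteq> \<beta>" "join ar B \<kappa> \<kappa>' = Nabla B"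
proof -
  let ?S = "(\<lambda>p. Cg ar B {p}) ` (\<alpha> \<union> \<beta>)"
  have sub: "\<alpha> \<union> \<beta> \<subseteq> Nabla B" using Con_subset_Nabla[OF \<alpha>] Con_subset_Nabla[OF \<beta>] by simp
  have S: "?S \<subseteq> Con ar B" using Cg_in_Con[OF B] by blast
  have "p \<in> Join ar B ?S" if "p \<in> \<alpha> \<union> \<beta>" for p
    using that sub subset_Cg[of "{p}" B ar] Join_ge[OF S, of "Cg ar B {p}"] by blast
  then have "Nabla B \<subseteq> Join ar B ?S"
    unfolding top[symmetric] by (intro join_least Join_in_Con B) blast+
  then obtain T where "T \<subseteq> ?S" "finite T" and T: "Nabla B \<subseteq> Join ar B T"
    using compact S unfolding K_def by blast
  then obtain E where E: "E \<subseteq> \<alpha> \<union> \<beta>" "finite E" "T = (\<lambda>p. Cg ar B {p}) ` E"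
    using finite_subset_image[of T "\<lambda>p. Cg ar B {p}" "\<alpha> \<union> \<beta>"] by blast
  define \<kappa> where "\<kappa> = Cg ar B (E \<inter> \<alpha>)"
  define \<kappa>' where "\<kappa>' = Cg ar B (E \<inter> \<beta>)"
  have "E \<inter> \<alpha> \<subseteq> Nabla B" "E \<inter> \<beta> \<subseteq> Nabla B" using sub by blast+
  then have K: "\<kappa> \<in> K ar B" "\<kappa>' \<in> K ar B" and gen: "E \<inter> \<alpha> \<subseteq> \<kappa>" "E \<inter> \<beta> \<subseteq> \<kappa>'"
    unfolding \<kappa>_def \<kappa>'_def using E(2) by (simp_all add: Cg_finite_compact[OF B] subset_Cg)
  have "E \<subseteq> join ar B \<kappa> \<kappa>'"
    using E(1) gen join_ge1[OF K[THEN K_in_Con]] join_ge2[OF K[THEN K_in_Con]] by blast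
  have "Cg ar B {p} \<subseteq> join ar B \<kappa> \<kappa>'" if "p \<in> E" for p
    using that \<open>E \<subseteq> join ar B \<kappa> \<kappa>'\<close> by (intro Cg_least join_in_Con B) blast
  then have "Join ar B T \<subseteq> join ar B \<kappa> \<kappa>'"
    unfolding E(3) by (intro Join_least join_in_Con B) auto
  then have "join ar B \<kappa> \<kappa>' = Nabla B"
    using T Con_subset_Nabla[OF join_in_Con[OF B]] by blast
  moreover have "\<kappa> \<subseteq> \<alpha>" "\<kappa>' \<subseteq> \<beta>" unfolding \<kappa>_def \<kappa>'_def by (simp_all add: Cg_least \<alpha> \<beta>)
  ultimately show ?thesis using K that by blast
qed

lemma compact_subset_Union_chain:
  assumes \<kappa>: "\<kappa> \<in> K ar B" and chain: "subset.chain (Con ar B) \<C>" and "\<C> \<noteq> {}" and "\<kappa> \<subseteq> \<Union>\<C>"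
  obtains X where "X \<in> \<C>" "\<kappa> \<subseteq> X"
proof -
  have \<C>: "\<C> \<subseteq> Con ar B" using chain by (simp add: subset.chain_def)
  then have "\<kappa> \<subseteq> Join ar B \<C>" using Join_ge[OF \<C>] \<open>\<kappa> \<subseteq> \<Union>\<C>\<close> by blast
  then obtain T where T: "T \<subseteq> \<C>" "finite T" "\<kappa> \<subseteq> Join ar B T"
    using \<kappa> \<C> unfolding K_def by blast
  obtain Y where "Y \<in> \<C>" using \<open>\<C> \<noteq> {}\<close> by blast
  then have "\<Union>(insert Y T) \<in> insert Y T"
    using T(1,2) chain
    by (intro Union_in_chain[of _ \<C>]) (simp_all add: subset_chain_def subset_iff)
  moreover have "insert Y T \<subseteq> \<C>" using T(1) \<open>Y \<in> \<C>\<close> by (intro insert_subsetI)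
  ultimately have X: "\<Union>(insert Y T) \<in> \<C>" by (rule rev_subsetD)
  then have "Join ar B T \<subseteq> \<Union>(insert Y T)" using \<C> by (intro Join_least) auto
  then show ?thesis using that[OF X] T(3) by blast
qed

lemma maximal_Con_above:
  assumes B: "algebra ar B" and compact: "Nabla B \<in> K ar B"
    and \<tau>: "\<tau> \<in> Con ar B" "\<tau> \<noteq> Nabla B"
  obtains M where "M \<in> Con ar B" "\<tau> \<subseteq> M" "M \<noteq> Nabla B"
    "\<And>\<chi>. \<chi> \<in> Con ar B \<Longrightarrow> M \<subseteq> \<chi> \<Longrightarrow> \<chi> \<noteq> Nabla B \<Longrightarrow> \<chi> = M"
proof -
  let ?S = "{\<chi> \<in> Con ar B. \<tau> \<subseteq> \<chi> \<and> \<chi> \<noteq> Nabla B}"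
  have "\<exists>M\<in>?S. \<forall>\<chi>\<in>?S. M \<subseteq> \<chi> \<longrightarrow> \<chi> = M"
  proof (rule subset_Zorn_nonempty)
    show "?S \<noteq> {}" using \<tau> by blast
    fix \<C> assume nonempty: "\<C> \<noteq> {}" and chain: "subset.chain ?S \<C>"
    have sub: "\<C> \<subseteq> ?S" using chain by (simp add: subset.chain_def)
    then have \<C>: "\<C> \<subseteq> Con ar B" by blast
    have "\<Union>\<C> \<in> Con ar B"
    proof (rule Con_directed_Union[OF B \<C> nonempty])
      show "\<exists>Z\<in>\<C>. X \<union> Y \<subseteq> Z" if "X \<in> \<C>" "Y \<in> \<C>" for X Y
      proof -
        have "X \<subseteq> Y \<or> Y \<subseteq> X" using chain that by (simp add: subset_chain_def)
        then show ?thesis using that by blast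
      qed
    qed
    moreover have "\<tau> \<subseteq> \<Union>\<C>" using nonempty sub by blast
    moreover have "\<Union>\<C> \<noteq> Nabla B"
    proof
      assume "\<Union>\<C> = Nabla B"
      moreover have "subset.chain (Con ar B) \<C>" using chain \<C> by (simp add: subset_chain_def)
      ultimately obtain X where "X \<in> \<C>" "Nabla B \<subseteq> X"
        using compact_subset_Union_chain[OF compact _ nonempty] by blast
      then show False using sub Con_subset_Nabla[of X ar B] by blast
    qed
    ultimately show "\<Union>\<C> \<in> ?S" by blast
  qed
  then obtain M where "M \<in> ?S" "\<forall>\<chi>\<in>?S. M \<subseteq> \<chi> \<longrightarrow> \<chi> = M" by blast
  then show ?thesis using that[of M] by (auto dest: order_trans)
qed

section \<open>Terms and homomorphisms\<close>

lemma eval_carrier: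
  "algebra ar B \<Longrightarrow> wf_term ar t \<Longrightarrow> range v \<subseteq> carrier B \<Longrightarrow> eval B v t \<in> carrier B"
  by (induction t) (auto intro!: algebra_ops)

lemma eval_Con:
  assumes "\<theta> \<in> Con ar B" and "\<And>x. (v x, w x) \<in> \<theta>" and "wf_term ar t"
  shows "(eval B v t, eval B w t) \<in> \<theta>"
  using assms(3)
proof (induction t)
  case (App f ts)
  then show ?case using Con_ops[OF assms(1), of "map (eval B v) ts" f "map (eval B w) ts"]
    by (auto simp: listrel_iff_nth)
qed (simp add: assms)

lemma eval_map_term: "eval B v (map_term id g t) = eval B (v \<circ> g) t"
  by (induction t) (auto simp: comp_def intro!: arg_cong[where f = "ops B _"])

lemma wf_map_term: "wf_term ar (map_term id g t) = wf_term ar t"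
  by (induction t) auto

definition homomorphism ::
  "('f \<Rightarrow> nat) \<Rightarrow> ('a, 'f) alg \<Rightarrow> ('b, 'f) alg \<Rightarrow> ('a \<Rightarrow> 'b) \<Rightarrow> bool" where
  "homomorphism ar B C h \<longleftrightarrow> h ` carrier B \<subseteq> carrier C \<and>
     (\<forall>f xs. length xs = ar f \<and> set xs \<subseteq> carrier B \<longrightarrow> h (ops B f xs) = ops C f (map h xs))"

lemma homomorphism_eval:
  assumes B: "algebra ar B" and h: "homomorphism ar B C h"
    and "wf_term ar t" and v: "range v \<subseteq> carrier B"
  shows "h (eval B v t) = eval C (h \<circ> v) t"
  using assms(3)
proof (induction t)
  case (App f ts)
  then have "set (map (eval B v) ts) \<subseteq> carrier B" using eval_carrier[OF B _ v] by auto
  then have "h (ops B f (map (eval B v) ts)) = ops C f (map h (map (eval B v) ts))"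
    using h App.prems by (simp add: homomorphism_def del: map_map)
  also have "map h (map (eval B v) ts) = map (eval C (h \<circ> v)) ts" using App by (simp add: comp_def)
  finally show ?case by (simp only: eval.simps)
qed simp

definition vimage_con :: "('a \<Rightarrow> 'b) \<Rightarrow> ('a, 'f) alg \<Rightarrow> ('b \<times> 'b) set \<Rightarrow> ('a \<times> 'a) set" where
  "vimage_con h B \<phi> = {(x, y) \<in> Nabla B. (h x, h y) \<in> \<phi>}"

definition image_con :: "('a \<Rightarrow> 'b) \<Rightarrow> ('a \<times> 'a) set \<Rightarrow> ('b \<times> 'b) set" where
  "image_con h \<chi> = map_prod h h ` \<chi>"

abbreviation kernel :: "('a \<Rightarrow> 'b) \<Rightarrow> ('a, 'f) alg \<Rightarrow> ('a \<times> 'a) set" where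
  "kernel h B \<equiv> vimage_con h B Id"

lemma in_vimage_con:
  "(x, y) \<in> vimage_con h B \<phi> \<longleftrightarrow> x \<in> carrier B \<and> y \<in> carrier B \<and> (h x, h y) \<in> \<phi>"
  by (simp add: vimage_con_def Nabla_def)

lemma vimage_con_mono: "\<phi> \<subseteq> \<psi> \<Longrightarrow> vimage_con h B \<phi> \<subseteq> vimage_con h B \<psi>"
  by (auto simp: vimage_con_def)

lemma vimage_con_Int: "vimage_con h B (\<phi> \<inter> \<psi>) = vimage_con h B \<phi> \<inter> vimage_con h B \<psi>"
  by (auto simp: vimage_con_def)

lemma image_con_mono: "\<chi> \<subseteq> \<psi> \<Longrightarrow> image_con h \<chi> \<subseteq> image_con h \<psi>"
  by (auto simp: image_con_def)

lemma vimage_con_in_Con: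
  assumes B: "algebra ar B" and h: "homomorphism ar B C h" and \<phi>: "\<phi> \<in> Con ar C"
  shows "vimage_con h B \<phi> \<in> Con ar B"
proof (rule ConI[OF B equivI])
  show "vimage_con h B \<phi> \<subseteq> carrier B \<times> carrier B" by (auto simp: in_vimage_con)
  show "refl_on (carrier B) (vimage_con h B \<phi>)"
    using h Con_refl[OF \<phi>] by (auto simp: in_vimage_con refl_on_def homomorphism_def)
  show "sym (vimage_con h B \<phi>)" using Con_sym[OF \<phi>] by (auto simp: in_vimage_con sym_def)
  show "trans (vimage_con h B \<phi>)"
    by (rule transI) (auto simp: in_vimage_con intro: Con_trans[OF \<phi>])
  fix f xs i y
  assume xs: "length xs = ar f" "set xs \<subseteq> carrier B" "i < length xs"
    and y: "(xs ! i, y) \<in> vimage_con h B \<phi>"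
  have update: "set (xs[i := y]) \<subseteq> carrier B"
    using set_update_subset_insert[of xs i y] xs y by (auto simp: in_vimage_con)
  have "set (map h xs) \<subseteq> carrier C" using xs h by (auto simp: homomorphism_def)
  then have "(ops C f (map h xs), ops C f (map h (xs[i := y]))) \<in> \<phi>"
    using Con_ops_update[OF \<phi>, of "map h xs" f i "h y"] xs y by (simp add: map_update in_vimage_con)
  then show "(ops B f xs, ops B f (xs[i := y])) \<in> vimage_con h B \<phi>"
    using xs update h algebra_ops[OF B] by (simp add: in_vimage_con homomorphism_def)
qed

locale epimorphism =
  fixes ar :: "'f \<Rightarrow> nat" and B :: "('a, 'f) alg" and C :: "('b, 'f) alg" and h :: "'a \<Rightarrow> 'b"
  assumes algebra_domain: "algebra ar B"
    and homomorphism: "homomorphism ar B C h"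
    and image_carrier: "h ` carrier B = carrier C"
begin

lemma hom_ops:
  "length xs = ar f \<Longrightarrow> set xs \<subseteq> carrier B \<Longrightarrow> h (ops B f xs) = ops C f (map h xs)"
  using homomorphism by (simp add: homomorphism_def)

lemma lift_list:
  assumes "set ys \<subseteq> carrier C"
  obtains xs where "ys = map h xs" "set xs \<subseteq> carrier B"
proof -
  have "ys \<in> map h ` lists (carrier B)"
    using assms by (auto simp: image_carrier simp flip: lists_image)
  then show ?thesis using that by auto
qed

lemma lift_valuation:
  assumes "range w \<subseteq> carrier C"
  obtains v where "range v \<subseteq> carrier B" "w = h \<circ> v"
proof -
  have "\<forall>x. \<exists>y. y \<in> carrier B \<and> w x = h y" using assms image_carrier by blast
  then obtain v where "\<forall>x. v x \<in> carrier B \<and> w x = h (v x)" by metis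
  then show ?thesis using that[of v] by (auto simp: fun_eq_iff)
qed

lemma algebra_codomain: "algebra ar C"
  unfolding algebra_def
proof (intro conjI allI impI)
  show "carrier C \<noteq> {}" using algebra_domain image_carrier by (auto simp: algebra_def)
  fix f ys assume ys: "length ys = ar f \<and> set ys \<subseteq> carrier C"
  then obtain xs where xs: "ys = map h xs" "set xs \<subseteq> carrier B" using lift_list by blast
  then have "ops C f ys = h (ops B f xs)" using ys hom_ops by simp
  also have "\<dots> \<in> carrier C"
    using xs ys algebra_ops[OF algebra_domain] by (auto simp flip: image_carrier)
  finally show "ops C f ys \<in> carrier C" .
qed

lemma inV_codomain:
  assumes wf: "\<forall>(s, t)\<in>Eqs. wf_term ar s \<and> wf_term ar t" and B: "inV ar Eqs B"
  shows "inV ar Eqs C"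
proof -
  have "eval C w s = eval C w t" if st: "(s, t) \<in> Eqs" and w: "range w \<subseteq> carrier C" for s t w
  proof -
    obtain v where v: "range v \<subseteq> carrier B" "w = h \<circ> v" by (rule lift_valuation[OF w])
    have "eval B v s = eval B v t" using B st v(1) by (auto simp: inV_def)
    moreover have "wf_term ar s" "wf_term ar t" using st wf by auto
    ultimately show ?thesis
      using homomorphism_eval[OF algebra_domain homomorphism _ v(1)] v(2) by metis
  qed
  then show ?thesis using algebra_codomain by (auto simp: inV_def)
qed

lemma vimage_in_Con: "\<phi> \<in> Con ar C \<Longrightarrow> vimage_con h B \<phi> \<in> Con ar B"
  by (rule vimage_con_in_Con[OF algebra_domain homomorphism])

lemma vimage_image_con:
  assumes \<chi>: "\<chi> \<in> Con ar B" and ker: "kernel h B \<subseteq> \<chi>"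
  shows "vimage_con h B (image_con h \<chi>) = \<chi>"
proof
  show "\<chi> \<subseteq> vimage_con h B (image_con h \<chi>)"
    using Con_carrier[OF \<chi>] by (auto simp: in_vimage_con image_con_def)
  show "vimage_con h B (image_con h \<chi>) \<subseteq> \<chi>"
  proof clarify
    fix x y assume "(x, y) \<in> vimage_con h B (image_con h \<chi>)"
    then obtain u v where "x \<in> carrier B" "y \<in> carrier B" "h x = h u" "h y = h v" "(u, v) \<in> \<chi>"
      by (auto simp: in_vimage_con image_con_def)
    then have "(x, u) \<in> \<chi>" "(u, v) \<in> \<chi>" "(v, y) \<in> \<chi>"
      using ker Con_carrier[OF \<chi> \<open>(u, v) \<in> \<chi>\<close>] by (auto simp: in_vimage_con)
    then show "(x, y) \<in> \<chi>" using Con_trans[OF \<chi>] by blast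
  qed
qed

lemma image_vimage_con:
  assumes "\<phi> \<subseteq> Nabla C"
  shows "image_con h (vimage_con h B \<phi>) = \<phi>"
proof
  show "image_con h (vimage_con h B \<phi>) \<subseteq> \<phi>" by (auto simp: vimage_con_def image_con_def)
  show "\<phi> \<subseteq> image_con h (vimage_con h B \<phi>)"
  proof clarify
    fix u v assume uv: "(u, v) \<in> \<phi>"
    then obtain x y where "u = h x" "v = h y" "x \<in> carrier B" "y \<in> carrier B"
      using assms by (auto simp: Nabla_def simp flip: image_carrier)
    then show "(u, v) \<in> image_con h (vimage_con h B \<phi>)"
      using uv unfolding image_con_def
      by (intro image_eqI[of _ _ "(x, y)"]) (auto simp: in_vimage_con)
  qed
qed

lemma image_con_iff:
  assumes "\<chi> \<in> Con ar B" and "kernel h B \<subseteq> \<chi>" and "x \<in> carrier B" and "y \<in> carrier B"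
  shows "(h x, h y) \<in> image_con h \<chi> \<longleftrightarrow> (x, y) \<in> \<chi>"
  using vimage_image_con[OF assms(1,2)] assms(3,4) in_vimage_con[of x y h B "image_con h \<chi>"] by simp

lemma image_in_Con:
  assumes \<chi>: "\<chi> \<in> Con ar B" and ker: "kernel h B \<subseteq> \<chi>"
  shows "image_con h \<chi> \<in> Con ar C"
proof (rule ConI[OF algebra_codomain equivI])
  note iff = image_con_iff[OF \<chi> ker]
  show sub: "image_con h \<chi> \<subseteq> carrier C \<times> carrier C"
    using Con_carrier[OF \<chi>] by (auto simp: image_con_def simp flip: image_carrier)
  show "refl_on (carrier C) (image_con h \<chi>)"
    using Con_refl[OF \<chi>] iff by (auto simp: refl_on_def simp flip: image_carrier)
  show "sym (image_con h \<chi>)" using Con_sym[OF \<chi>] by (force simp: image_con_def sym_def)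
  show "trans (image_con h \<chi>)"
  proof (rule transI)
    fix u v w assume rel: "(u, v) \<in> image_con h \<chi>" "(v, w) \<in> image_con h \<chi>"
    then have "u \<in> h ` carrier B" "v \<in> h ` carrier B" "w \<in> h ` carrier B"
      using sub by (auto simp: image_carrier)
    then obtain x y z where "x \<in> carrier B" "y \<in> carrier B" "z \<in> carrier B"
      "u = h x" "v = h y" "w = h z" by blast
    then show "(u, w) \<in> image_con h \<chi>" using rel iff Con_trans[OF \<chi>, of x y z] by simp
  qed
  fix f ys i v
  assume ys: "length ys = ar f" "set ys \<subseteq> carrier C" "i < length ys"
    and v: "(ys ! i, v) \<in> image_con h \<chi>"
  obtain xs where xs: "ys = map h xs" "set xs \<subseteq> carrier B" using ys(2) by (rule lift_list)
  obtain y where y: "v = h y" "y \<in> carrier B"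
    using v sub by (auto simp flip: image_carrier)
  have "xs ! i \<in> carrier B" using xs ys(3) nth_mem by force
  then have "(xs ! i, y) \<in> \<chi>" using v iff y xs ys(3) by simp
  then have "(ops B f xs, ops B f (xs[i := y])) \<in> \<chi>"
    using xs ys by (intro Con_ops_update[OF \<chi>]) auto
  moreover have "set (xs[i := y]) \<subseteq> carrier B"
    using set_update_subset_insert[of xs i y] xs(2) y(2) by blast
  then have "ops C f ys = h (ops B f xs)" "ops C f (ys[i := v]) = h (ops B f (xs[i := y]))"
    using xs y ys hom_ops by (simp_all add: map_update)
  ultimately show "(ops C f ys, ops C f (ys[i := v])) \<in> image_con h \<chi>"
    by (force simp: image_con_def)
qed

lemma kernel_subset_vimage: "\<phi> \<in> Con ar C \<Longrightarrow> kernel h B \<subseteq> vimage_con h B \<phi>"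
  using Con_refl[of \<phi> ar C] by (auto simp: in_vimage_con simp flip: image_carrier)

lemma vimage_con_subset_iff:
  assumes \<phi>: "\<phi> \<in> Con ar C" and \<chi>: "\<chi> \<in> Con ar B" "kernel h B \<subseteq> \<chi>"
  shows "vimage_con h B \<phi> \<subseteq> \<chi> \<longleftrightarrow> \<phi> \<subseteq> image_con h \<chi>"
  using image_con_mono[of "vimage_con h B \<phi>" \<chi> h] vimage_con_mono[of \<phi> "image_con h \<chi>" h B]
    image_vimage_con[OF Con_subset_Nabla[OF \<phi>]] vimage_image_con[OF \<chi>] by auto

lemma image_con_eq_iff:
  assumes \<phi>: "\<phi> \<in> Con ar C" and \<chi>: "\<chi> \<in> Con ar B" "kernel h B \<subseteq> \<chi>"
  shows "image_con h \<chi> = \<phi> \<longleftrightarrow> \<chi> = vimage_con h B \<phi>"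
  using image_vimage_con[OF Con_subset_Nabla[OF \<phi>]] vimage_image_con[OF \<chi>] by auto

lemma vimage_con_inject:
  "\<phi> \<subseteq> Nabla C \<Longrightarrow> \<psi> \<subseteq> Nabla C \<Longrightarrow> vimage_con h B \<phi> = vimage_con h B \<psi> \<longleftrightarrow> \<phi> = \<psi>"
  using image_vimage_con by metis

lemma vimage_con_subset_vimage_con_iff:
  "\<phi> \<subseteq> Nabla C \<Longrightarrow> \<psi> \<subseteq> Nabla C \<Longrightarrow> vimage_con h B \<phi> \<subseteq> vimage_con h B \<psi> \<longleftrightarrow> \<phi> \<subseteq> \<psi>"
  using image_con_mono[of "vimage_con h B \<phi>" "vimage_con h B \<psi>" h] vimage_con_mono[of \<phi> \<psi> h B]
  by (auto simp: image_vimage_con)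

lemma vimage_con_Nabla: "vimage_con h B (Nabla C) = Nabla B"
  by (auto simp: vimage_con_def Nabla_def simp flip: image_carrier)

lemma vimage_con_Delta: "vimage_con h B (Delta C) = kernel h B"
  by (auto simp: vimage_con_def Nabla_def Delta_def simp flip: image_carrier)

lemma vimage_con_Join:
  assumes S: "S \<subseteq> Con ar C" "S \<noteq> {}"
  shows "vimage_con h B (Join ar C S) = Join ar B (vimage_con h B ` S)" (is "_ = ?J")
proof
  have sub: "vimage_con h B ` S \<subseteq> Con ar B" using S(1) vimage_in_Con by blast
  have ge: "vimage_con h B \<phi> \<subseteq> ?J" if "\<phi> \<in> S" for \<phi>
    using that by (intro Join_ge[OF sub]) blast
  have J: "?J \<in> Con ar B" by (rule Join_in_Con[OF algebra_domain])
  obtain \<phi> where "\<phi> \<in> S" using S(2) by blast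
  then have ker: "kernel h B \<subseteq> ?J"
    using ge[of \<phi>] kernel_subset_vimage[of \<phi>] S(1) by blast
  have "\<phi> \<subseteq> image_con h ?J" if "\<phi> \<in> S" for \<phi>
    using ge[OF that] vimage_con_subset_iff[OF _ J ker] that S(1) by blast
  then have "Join ar C S \<subseteq> image_con h ?J" by (rule Join_least[OF image_in_Con[OF J ker]])
  then show "vimage_con h B (Join ar C S) \<subseteq> ?J"
    using vimage_con_subset_iff[OF Join_in_Con[OF algebra_codomain] J ker] by simp
  show "?J \<subseteq> vimage_con h B (Join ar C S)"
  proof (rule Join_least)
    show "vimage_con h B (Join ar C S) \<in> Con ar B"
      by (intro vimage_in_Con Join_in_Con algebra_codomain)
    show "\<alpha> \<subseteq> vimage_con h B (Join ar C S)" if "\<alpha> \<in> vimage_con h B ` S" for \<alpha>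
      using that vimage_con_mono[OF Join_ge[OF S(1)]] by (elim imageE) simp
  qed
qed

lemma vimage_con_join:
  "\<phi> \<in> Con ar C \<Longrightarrow> \<psi> \<in> Con ar C
    \<Longrightarrow> vimage_con h B (join ar C \<phi> \<psi>) = join ar B (vimage_con h B \<phi>) (vimage_con h B \<psi>)"
  unfolding join_def by (simp add: vimage_con_Join)

lemma modular_Con_domain:
  assumes C: "modular_Con ar C" and ker: "kernel h B = Delta B"
  shows "modular_Con ar B"
  unfolding modular_Con_def
proof (intro ballI impI)
  fix \<alpha> \<beta> \<gamma> assume Con: "\<alpha> \<in> Con ar B" "\<beta> \<in> Con ar B" "\<gamma> \<in> Con ar B" and "\<alpha> \<subseteq> \<gamma>"
  have image: "image_con h \<chi> \<in> Con ar C" "vimage_con h B (image_con h \<chi>) = \<chi>"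
    if "\<chi> \<in> Con ar B" for \<chi>
    using image_in_Con[OF that] vimage_image_con[OF that] Delta_subset_Con[OF that]
    by (simp_all add: ker)
  note modular = C[unfolded modular_Con_def, rule_format, OF Con[THEN image(1)]]
  have "join ar C (image_con h \<alpha>) (image_con h \<beta> \<inter> image_con h \<gamma>)
      = join ar C (image_con h \<alpha>) (image_con h \<beta>) \<inter> image_con h \<gamma>"
    using \<open>\<alpha> \<subseteq> \<gamma>\<close> by (intro modular image_con_mono)
  then have "vimage_con h B (join ar C (image_con h \<alpha>) (image_con h \<beta> \<inter> image_con h \<gamma>))
      = vimage_con h B (join ar C (image_con h \<alpha>) (image_con h \<beta>) \<inter> image_con h \<gamma>)" by simp
  then show "join ar B \<alpha> (\<beta> \<inter> \<gamma>) = join ar B \<alpha> \<beta> \<inter> \<gamma>"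
    using Con by (simp add: vimage_con_join vimage_con_Int image Int_in_Con algebra_codomain)
qed

lemma Nabla_compact_codomain:
  assumes compact: "Nabla B \<in> K ar B"
  shows "Nabla C \<in> K ar C"
proof -
  have "\<exists>T\<subseteq>S. finite T \<and> Nabla C \<subseteq> Join ar C T"
    if S: "S \<subseteq> Con ar C" and cover: "Nabla C \<subseteq> Join ar C S" for S
  proof (cases "S = {}")
    case False
    have "Nabla B \<subseteq> Join ar B (vimage_con h B ` S)"
      using vimage_con_mono[OF cover, of h B]
      by (simp add: vimage_con_Nabla vimage_con_Join[OF S False])
    moreover have "vimage_con h B ` S \<subseteq> Con ar B" using S vimage_in_Con by blast
    ultimately obtain U where U: "U \<subseteq> vimage_con h B ` S" "finite U" "Nabla B \<subseteq> Join ar B U"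
      using compact unfolding K_def by blast
    obtain T where T: "T \<subseteq> S" "finite T" "U = vimage_con h B ` T"
      using finite_subset_image[OF U(2,1)] by (elim exE conjE)
    obtain \<phi> where "\<phi> \<in> S" using False by blast
    then have ins: "insert \<phi> T \<subseteq> Con ar C" "insert \<phi> T \<subseteq> S" using T(1) S by blast+
    have "Nabla B \<subseteq> Join ar B (vimage_con h B ` insert \<phi> T)"
      using U(3) T(3) Join_mono[of U "vimage_con h B ` insert \<phi> T" ar B] by auto
    then have "vimage_con h B (Nabla C) \<subseteq> vimage_con h B (Join ar C (insert \<phi> T))"
      using ins by (simp add: vimage_con_Nabla vimage_con_Join)
    then have "Nabla C \<subseteq> Join ar C (insert \<phi> T)"
      using Con_subset_Nabla[OF Join_in_Con[OF algebra_codomain]]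
      by (simp add: vimage_con_subset_vimage_con_iff)
    then show ?thesis using ins T(2) by (intro exI[of _ "insert \<phi> T"]) simp
  qed (use cover in auto)
  then show ?thesis by (simp add: K_def Nabla_in_Con[OF algebra_codomain])
qed

lemma kernel_eq_NablaI:
  assumes C: "no_trivial_subalg ar C" and x: "x \<in> carrier B"
    and idem: "\<And>f. (ops B f (replicate (ar f) x), x) \<in> kernel h B"
  shows "kernel h B = Nabla B"
proof -
  have "ops C f (replicate (ar f) (h x)) = h x" for f
    using hom_ops[of "replicate (ar f) x" f] x idem[of f]
    by (simp add: in_vimage_con set_replicate_conv_if)
  then have "\<forall>u\<in>carrier C. \<forall>v\<in>carrier C. u = v"
    using C x image_carrier unfolding no_trivial_subalg_def by blast
  then show ?thesis by (auto simp: vimage_con_def Nabla_def simp flip: image_carrier)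
qed

end

lemma epimorphism_exists:
  assumes B: "algebra ar B" and \<theta>: "\<theta> \<in> Con ar B"
    and ker: "\<And>x y. x \<in> carrier B \<Longrightarrow> y \<in> carrier B \<Longrightarrow> h x = h y \<longleftrightarrow> (x, y) \<in> \<theta>"
  obtains C where "epimorphism ar B C h"
proof -
  let ?g = "inv_into (carrier B) h"
  let ?C = "\<lparr>carrier = h ` carrier B, ops = \<lambda>f ys. h (ops B f (map ?g ys))\<rparr>"
  have "h (ops B f xs) = h (ops B f (map ?g (map h xs)))"
    if "length xs = ar f" "set xs \<subseteq> carrier B" for f xs
  proof -
    have "(x, ?g (h x)) \<in> \<theta>" if "x \<in> carrier B" for x
      using that inv_into_into[of "h x" h "carrier B"] f_inv_into_f[of "h x" h "carrier B"]
        ker[of x "?g (h x)"] by simp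
    then have "(ops B f xs, ops B f (map ?g (map h xs))) \<in> \<theta>"
      using that by (intro Con_ops[OF \<theta>]) (auto simp: listrel_iff_nth subset_iff)
    then show ?thesis using ker Con_carrier[OF \<theta>] by blast
  qed
  then have "epimorphism ar B ?C h"
    using B by (simp add: epimorphism_def homomorphism_def)
  then show ?thesis by (rule that)
qed

lemma epimorphism_quot:
  assumes B: "algebra ar B" and \<theta>: "\<theta> \<in> Con ar B"
  shows "epimorphism ar B (quot B \<theta>) (\<lambda>x. \<theta> `` {x})"
proof
  show "algebra ar B" by (rule B)
  show "(\<lambda>x. \<theta> `` {x}) ` carrier B = carrier (quot B \<theta>)"
    by (auto simp: quot_def quotient_def)
  have "\<theta> `` {ops B f xs} = ops (quot B \<theta>) f (map (\<lambda>x. \<theta> `` {x}) xs)"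
    if len: "length xs = ar f" and xs: "set xs \<subseteq> carrier B" for f xs
  proof -
    have "(x, SOME y. y \<in> \<theta> `` {x}) \<in> \<theta>" if "x \<in> carrier B" for x
      using someI[of "\<lambda>y. y \<in> \<theta> `` {x}" x] Con_refl[OF \<theta> that] by simp
    then have "(xs, map (\<lambda>x. SOME y. y \<in> \<theta> `` {x}) xs) \<in> listrel \<theta>"
      using xs by (auto simp: listrel_iff_nth subset_iff)
    then show ?thesis
      using equiv_class_eq[OF Con_equiv[OF \<theta>] Con_ops[OF \<theta> len]] by (simp add: quot_def comp_def)
  qed
  then show "homomorphism ar B (quot B \<theta>) (\<lambda>x. \<theta> `` {x})"
    by (auto simp: homomorphism_def quot_def quotientI)
qed

lemma kernel_quot:
  assumes \<theta>: "\<theta> \<in> Con ar B"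
  shows "kernel (\<lambda>x. \<theta> `` {x}) B = \<theta>"
  using eq_equiv_class_iff[OF Con_equiv[OF \<theta>]] Con_carrier[OF \<theta>] by (auto simp: in_vimage_con)

lemma quot_con_eq_image_con: "quot_con \<theta> \<chi> = image_con (\<lambda>x. \<theta> `` {x}) \<chi>"
  by (force simp: quot_con_def image_con_def)

section \<open>A congruence as a subalgebra of the square\<close>

definition pair_alg :: "('a, 'f) alg \<Rightarrow> ('a \<times> 'a) set \<Rightarrow> ('a \<times> 'a, 'f) alg" where
  "pair_alg B \<beta> = \<lparr>carrier = \<beta>, ops = \<lambda>f ps. (ops B f (map fst ps), ops B f (map snd ps))\<rparr>"

lemma pair_alg_simps [simp]:
  "carrier (pair_alg B \<beta>) = \<beta>"
  "ops (pair_alg B \<beta>) f ps = (ops B f (map fst ps), ops B f (map snd ps))"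
  by (simp_all add: pair_alg_def)

lemma eval_pair_alg:
  "eval (pair_alg B \<beta>) v t = (eval B (fst \<circ> v) t, eval B (snd \<circ> v) t)"
  by (induction t) (auto simp: comp_def intro!: arg_cong[where f = "ops B _"])

lemma pair_alg_algebra:
  assumes B: "algebra ar B" and \<beta>: "\<beta> \<in> Con ar B"
  shows "algebra ar (pair_alg B \<beta>)"
proof -
  have "\<beta> \<noteq> {}" using B Con_refl[OF \<beta>] by (auto simp: algebra_def)
  moreover have "(ops B f (map fst ps), ops B f (map snd ps)) \<in> \<beta>"
    if "length ps = ar f" "set ps \<subseteq> \<beta>" for f ps
    using that by (intro Con_ops[OF \<beta>]) (auto simp: listrel_iff_nth dest!: nth_mem)
  ultimately show ?thesis by (simp add: algebra_def)
qed

lemma pair_alg_inV: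
  assumes B: "inV ar Eqs B" and \<beta>: "\<beta> \<in> Con ar B"
  shows "inV ar Eqs (pair_alg B \<beta>)"
proof -
  have "range (fst \<circ> v) \<subseteq> carrier B \<and> range (snd \<circ> v) \<subseteq> carrier B" if "range v \<subseteq> \<beta>"
    for v :: "nat \<Rightarrow> _"
    using that Con_subset_Nabla[OF \<beta>] by (fastforce simp: Nabla_def)
  then show ?thesis
    using B pair_alg_algebra[OF _ \<beta>] by (fastforce simp: inV_def eval_pair_alg)
qed

lemma
  assumes \<beta>: "\<beta> \<in> Con ar B"
  shows homomorphism_fst: "homomorphism ar (pair_alg B \<beta>) B fst"
    and homomorphism_snd: "homomorphism ar (pair_alg B \<beta>) B snd"
    and homomorphism_diagonal: "homomorphism ar B (pair_alg B \<beta>) (\<lambda>x. (x, x))"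
    and homomorphism_swap: "homomorphism ar (pair_alg B \<beta>) (pair_alg B \<beta>) prod.swap"
  by (auto simp: homomorphism_def comp_def dest: Con_carrier[OF \<beta>]
      intro: Con_refl[OF \<beta>] Con_sym[OF \<beta>])

lemma
  assumes B: "algebra ar B" and \<beta>: "\<beta> \<in> Con ar B"
  shows vimage_fst_in_Con: "\<phi> \<in> Con ar B \<Longrightarrow> vimage_con fst (pair_alg B \<beta>) \<phi> \<in> Con ar (pair_alg B \<beta>)"
    and vimage_snd_in_Con: "\<phi> \<in> Con ar B \<Longrightarrow> vimage_con snd (pair_alg B \<beta>) \<phi> \<in> Con ar (pair_alg B \<beta>)"
    and vimage_swap_in_Con: "\<Phi> \<in> Con ar (pair_alg B \<beta>)
      \<Longrightarrow> vimage_con prod.swap (pair_alg B \<beta>) \<Phi> \<in> Con ar (pair_alg B \<beta>)"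
  using vimage_con_in_Con[OF pair_alg_algebra[OF B \<beta>]]
    homomorphism_fst[OF \<beta>] homomorphism_snd[OF \<beta>] homomorphism_swap[OF \<beta>] by metis+

definition diag_con ::
  "('f \<Rightarrow> nat) \<Rightarrow> ('a, 'f) alg \<Rightarrow> ('a \<times> 'a) set \<Rightarrow> ('a \<times> 'a) set \<Rightarrow> (('a \<times> 'a) \<times> 'a \<times> 'a) set"
  where "diag_con ar B \<beta> \<alpha> = Cg ar (pair_alg B \<beta>) ((\<lambda>(x, y). ((x, x), (y, y))) ` \<alpha>)"

lemma diag_con_in_Con:
  "algebra ar B \<Longrightarrow> \<beta> \<in> Con ar B \<Longrightarrow> diag_con ar B \<beta> \<alpha> \<in> Con ar (pair_alg B \<beta>)"
  by (simp add: diag_con_def Cg_in_Con pair_alg_algebra)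

lemma diag_con_least:
  "\<theta> \<in> Con ar (pair_alg B \<beta>) \<Longrightarrow> (\<And>x y. (x, y) \<in> \<alpha> \<Longrightarrow> ((x, x), (y, y)) \<in> \<theta>)
    \<Longrightarrow> diag_con ar B \<beta> \<alpha> \<subseteq> \<theta>"
  unfolding diag_con_def by (rule Cg_least) auto

lemma diagonal_in_diag_con:
  assumes \<beta>: "\<beta> \<in> Con ar B" and \<alpha>: "\<alpha> \<in> Con ar B" and "(x, y) \<in> \<alpha>"
  shows "((x, x), (y, y)) \<in> diag_con ar B \<beta> \<alpha>"
proof -
  let ?R = "(\<lambda>(x, y). ((x, x), (y, y))) ` \<alpha>"
  have "?R \<subseteq> Nabla (pair_alg B \<beta>)"
    using Con_carrier[OF \<alpha>] Con_refl[OF \<beta>] by (auto simp: Nabla_def)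
  then have "?R \<subseteq> diag_con ar B \<beta> \<alpha>" unfolding diag_con_def by (rule subset_Cg)
  then show ?thesis using assms(3) by force
qed

lemma diag_con_coordinates:
  assumes B: "algebra ar B" and \<alpha>: "\<alpha> \<in> Con ar B" and \<beta>: "\<beta> \<in> Con ar B"
    and D: "((x, y), (z, u)) \<in> diag_con ar B \<beta> \<alpha>"
  shows "(x, z) \<in> \<alpha>" "(y, u) \<in> \<alpha>"
proof -
  have "diag_con ar B \<beta> \<alpha> \<subseteq> vimage_con h (pair_alg B \<beta>) \<alpha>"
    if "homomorphism ar (pair_alg B \<beta>) B h" "\<And>x. h (x, x) = x" for h
    using vimage_con_in_Con[OF pair_alg_algebra[OF B \<beta>] that(1) \<alpha>]
    by (rule diag_con_least)
      (use that(2) Con_carrier[OF \<alpha>] Con_refl[OF \<beta>] in \<open>simp add: in_vimage_con\<close>)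
  from this[OF homomorphism_fst[OF \<beta>]] this[OF homomorphism_snd[OF \<beta>]] D
  show "(x, z) \<in> \<alpha>" "(y, u) \<in> \<alpha>" by (auto simp: vimage_con_def)
qed

lemma diag_con_rows:
  assumes "algebra ar B" and "\<beta> \<in> Con ar B" and "((x, y), (z, u)) \<in> diag_con ar B \<beta> \<alpha>"
  shows "(x, y) \<in> \<beta>" "(z, u) \<in> \<beta>"
  using Con_carrier[OF diag_con_in_Con[OF assms(1,2)] assms(3)] by simp_all

lemma diag_con_swap:
  assumes B: "algebra ar B" and \<alpha>: "\<alpha> \<in> Con ar B" and \<beta>: "\<beta> \<in> Con ar B"
    and D: "((x, y), (z, u)) \<in> diag_con ar B \<beta> \<alpha>"
  shows "((y, x), (u, z)) \<in> diag_con ar B \<beta> \<alpha>"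
proof -
  have "vimage_con prod.swap (pair_alg B \<beta>) (diag_con ar B \<beta> \<alpha>) \<in> Con ar (pair_alg B \<beta>)"
    by (rule vimage_swap_in_Con[OF B \<beta> diag_con_in_Con[OF B \<beta>]])
  then have "diag_con ar B \<beta> \<alpha> \<subseteq> vimage_con prod.swap (pair_alg B \<beta>) (diag_con ar B \<beta> \<alpha>)"
    by (rule diag_con_least)
      (use diagonal_in_diag_con[OF \<beta> \<alpha>] Con_carrier[OF \<alpha>] Con_refl[OF \<beta>]
        in \<open>simp add: in_vimage_con\<close>)
  then show ?thesis using D by (auto simp: in_vimage_con)
qed

lemma diag_con_join_subset:
  assumes B: "algebra ar B" and \<alpha>: "\<alpha> \<in> Con ar B" and \<alpha>': "\<alpha>' \<in> Con ar B" and \<beta>: "\<beta> \<in> Con ar B"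
  shows "diag_con ar B \<beta> (join ar B \<alpha> \<alpha>')
    \<subseteq> join ar (pair_alg B \<beta>) (diag_con ar B \<beta> \<alpha>) (diag_con ar B \<beta> \<alpha>')" (is "_ \<subseteq> ?J")
proof -
  note P = pair_alg_algebra[OF B \<beta>] and D = diag_con_in_Con[OF B \<beta>]
  have J: "?J \<in> Con ar (pair_alg B \<beta>)" by (rule join_in_Con[OF P])
  let ?E = "vimage_con (\<lambda>x. (x, x)) B ?J"
  have "((x, x), (y, y)) \<in> ?J" if "(x, y) \<in> \<alpha> \<union> \<alpha>'" for x y
    using that join_ge1[OF D[of \<alpha>] D[of \<alpha>']] join_ge2[OF D[of \<alpha>] D[of \<alpha>']]
      diagonal_in_diag_con[OF \<beta> \<alpha>] diagonal_in_diag_con[OF \<beta> \<alpha>'] by blast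
  then have "\<alpha> \<subseteq> ?E" "\<alpha>' \<subseteq> ?E"
    using Con_carrier[OF \<alpha>] Con_carrier[OF \<alpha>'] by (auto simp: in_vimage_con)
  then have "join ar B \<alpha> \<alpha>' \<subseteq> ?E"
    by (intro join_least vimage_con_in_Con[OF B homomorphism_diagonal[OF \<beta>] J])
  then show ?thesis by (intro diag_con_least J) (auto simp: in_vimage_con)
qed

section \<open>The term condition\<close>

definition term_matrices ::
  "('f \<Rightarrow> nat) \<Rightarrow> ('a, 'f) alg \<Rightarrow> ('a \<times> 'a) set \<Rightarrow> ('a \<times> 'a) set \<Rightarrow> (('a \<times> 'a) \<times> 'a \<times> 'a) set"
  where "term_matrices ar B \<alpha> \<beta> =
    {((eval B (case_sum a c) t, eval B (case_sum a d) t),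
      (eval B (case_sum b c) t, eval B (case_sum b d) t)) | (t :: ('f, nat + nat) term) a b c d.
      wf_term ar t \<and> (\<forall>i. (a i, b i) \<in> \<alpha>) \<and> (\<forall>j. (c j, d j) \<in> \<beta>)}"

lemma term_matricesI:
  fixes t :: "('f, nat + nat) term"
  assumes "wf_term ar t" and "\<And>i. (a i, b i) \<in> \<alpha>" and "\<And>j. (c j, d j) \<in> \<beta>"
    and "p = (eval B (case_sum a c) t, eval B (case_sum a d) t)"
    and "q = (eval B (case_sum b c) t, eval B (case_sum b d) t)"
  shows "(p, q) \<in> term_matrices ar B \<alpha> \<beta>"
  using assms unfolding term_matrices_def by blast

lemma term_matricesE:
  fixes ar :: "'f \<Rightarrow> nat"
  assumes "(p, q) \<in> term_matrices ar B \<alpha> \<beta>"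
  obtains t :: "('f, nat + nat) term" and a b c d
  where "wf_term ar t" "\<forall>i. (a i, b i) \<in> \<alpha>" "\<forall>j. (c j, d j) \<in> \<beta>"
    "p = (eval B (case_sum a c) t, eval B (case_sum a d) t)"
    "q = (eval B (case_sum b c) t, eval B (case_sum b d) t)"
  using assms unfolding term_matrices_def by blast

lemma centralizes_iff_term_matrices:
  "centralizes ar B \<alpha> \<beta> \<delta> \<longleftrightarrow> (\<forall>(p, q) \<in> term_matrices ar B \<alpha> \<beta>. p \<in> \<delta> \<longrightarrow> q \<in> \<delta>)"
  unfolding centralizes_def term_matrices_def by blast

lemma term_matrices_transpose:
  fixes ar :: "'f \<Rightarrow> nat" and B :: "('a, 'f) alg"
  assumes "((x, y), (z, u)) \<in> term_matrices ar B \<alpha> \<beta>"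
  shows "((x, z), (y, u)) \<in> term_matrices ar B \<beta> \<alpha>"
proof -
  obtain t :: "('f, nat + nat) term" and a b c d
    where t: "wf_term ar t" and ab: "\<forall>i. (a i, b i) \<in> \<alpha>" and cd: "\<forall>j. (c j, d j) \<in> \<beta>"
      and eqs: "(x, y) = (eval B (case_sum a c) t, eval B (case_sum a d) t)"
        "(z, u) = (eval B (case_sum b c) t, eval B (case_sum b d) t)"
    using assms by (blast elim: term_matricesE)
  let ?s = "map_term id (case_sum Inr Inl) t"
  have "case_sum e' e \<circ> case_sum Inr Inl = case_sum e e'" for e e' :: "nat \<Rightarrow> 'a"
    by (auto simp: fun_eq_iff split: sum.split)
  then have "eval B (case_sum e' e) ?s = eval B (case_sum e e') t" for e e'
    by (simp only: eval_map_term)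
  then show ?thesis
    using eqs t cd ab
    by (intro term_matricesI[where t = ?s and a = c and b = d and c = a and d = b])
      (simp_all add: wf_map_term)
qed

lemma term_matrices_subset_diag_con:
  fixes ar :: "'f \<Rightarrow> nat" and B :: "('a, 'f) alg"
  assumes B: "algebra ar B" and \<alpha>: "\<alpha> \<in> Con ar B" and \<beta>: "\<beta> \<in> Con ar B"
  shows "term_matrices ar B \<alpha> \<beta> \<subseteq> diag_con ar B \<beta> \<alpha>"
proof clarify
  fix x y z u assume "((x, y), (z, u)) \<in> term_matrices ar B \<alpha> \<beta>"
  then obtain t :: "('f, nat + nat) term" and a b c d
    where t: "wf_term ar t" and ab: "\<forall>i. (a i, b i) \<in> \<alpha>" and cd: "\<forall>j. (c j, d j) \<in> \<beta>"
      and xyzu: "(x, y) = (eval B (case_sum a c) t, eval B (case_sum a d) t)"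
        "(z, u) = (eval B (case_sum b c) t, eval B (case_sum b d) t)"
    by (blast elim: term_matricesE)
  let ?v = "\<lambda>e. case_sum (\<lambda>i. (e i, e i)) (\<lambda>j. (c j, d j))"
  note D = diag_con_in_Con[OF B \<beta>]
  have "(?v a k, ?v b k) \<in> diag_con ar B \<beta> \<alpha>" for k
    using diagonal_in_diag_con[OF \<beta> \<alpha>] ab Con_refl[OF D] cd by (cases k) auto
  then have "(eval (pair_alg B \<beta>) (?v a) t, eval (pair_alg B \<beta>) (?v b) t) \<in> diag_con ar B \<beta> \<alpha>"
    by (rule eval_Con[OF D]) (rule t)
  moreover have "fst \<circ> ?v e = case_sum e c" "snd \<circ> ?v e = case_sum e d" for e :: "nat \<Rightarrow> 'a"
    by (auto simp: fun_eq_iff split: sum.split)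
  ultimately show "((x, y), (z, u)) \<in> diag_con ar B \<beta> \<alpha>" using xyzu by (simp add: eval_pair_alg)
qed

lemma term_matrices_ops_update:
  fixes ar :: "'f \<Rightarrow> nat" and B :: "('a, 'f) alg"
  assumes len: "length ps = ar f" and ps: "set ps \<subseteq> \<beta>"
    and M: "(ps ! i, q) \<in> term_matrices ar B \<alpha> \<beta>"
  shows "(ops (pair_alg B \<beta>) f ps, ops (pair_alg B \<beta>) f (ps[i := q])) \<in> term_matrices ar B \<alpha> \<beta>"
proof -
  obtain t :: "('f, nat + nat) term" and a b c d
    where t: "wf_term ar t" and ab: "\<forall>i. (a i, b i) \<in> \<alpha>" and cd: "\<forall>j. (c j, d j) \<in> \<beta>"
      and p: "ps ! i = (eval B (case_sum a c) t, eval B (case_sum a d) t)"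
      and q: "q = (eval B (case_sum b c) t, eval B (case_sum b d) t)"
    using M by (blast elim: term_matricesE)
  \<comment> \<open>The first \<open>ar f\<close> right-hand variables name the entries of \<open>ps\<close>; those of \<open>t\<close> are shifted.\<close>
  define pad where "pad g e j = (if j < ar f then g (ps ! j) else e (j - ar f))"
    for g :: "'a \<times> 'a \<Rightarrow> 'a" and e j
  define s where
    "s = App f ((map (Var \<circ> Inr) [0..<ar f])[i := map_term id (map_sum id (\<lambda>j. j + ar f)) t])"
  have shift: "case_sum e (pad g e') \<circ> map_sum id (\<lambda>j. j + ar f) = case_sum e e'" for e g e'
    by (auto simp: fun_eq_iff pad_def split: sum.split)
  have pad: "map (pad g e) [0..<ar f] = map g ps" for g e
    by (rule nth_equalityI) (simp_all add: pad_def len)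
  have s: "eval B (case_sum e (pad g e')) s = ops B f ((map g ps)[i := eval B (case_sum e e') t])"
    for e g e'
    by (simp add: s_def map_update eval_map_term shift comp_def[of "eval B _"] pad)
  show ?thesis
  proof (rule term_matricesI[where t = s and a = a and b = b
        and c = "pad fst c" and d = "pad snd d"])
    show "wf_term ar s"
      using t set_update_subset_insert[of "map (Var \<circ> Inr) [0..<ar f]" i]
      by (fastforce simp: s_def wf_map_term)
    show "(pad fst c j, pad snd d j) \<in> \<beta>" for j
      using ps cd len by (auto simp: pad_def)
    have "(map fst ps)[i := fst (ps ! i)] = map fst ps"
      "(map snd ps)[i := snd (ps ! i)] = map snd ps"
      by (simp_all flip: map_update)
    then show "ops (pair_alg B \<beta>) f ps =
        (eval B (case_sum a (pad fst c)) s, eval B (case_sum a (pad snd d)) s)"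
      by (simp add: s p)
    show "ops (pair_alg B \<beta>) f (ps[i := q]) =
        (eval B (case_sum b (pad fst c)) s, eval B (case_sum b (pad snd d)) s)"
      by (simp add: s q map_update)
  qed (use ab in simp)
qed

lemma diag_con_eq_trancl_term_matrices:
  fixes ar :: "'f \<Rightarrow> nat" and B :: "('a, 'f) alg"
  assumes B: "algebra ar B" and \<alpha>: "\<alpha> \<in> Con ar B" and \<beta>: "\<beta> \<in> Con ar B"
  shows "diag_con ar B \<beta> \<alpha> = (term_matrices ar B \<alpha> \<beta>)\<^sup>+" (is "_ = ?M\<^sup>+")
proof
  note M_subset = term_matrices_subset_diag_con[OF B \<alpha> \<beta>]
  have "trans (diag_con ar B \<beta> \<alpha>)"
    using Con_equiv[OF diag_con_in_Con[OF B \<beta>]] by (simp add: equiv_def)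
  then show "?M\<^sup>+ \<subseteq> diag_con ar B \<beta> \<alpha>" using trancl_mono_subset[OF M_subset] by simp
  obtain x0 where x0: "x0 \<in> carrier B" using B by (auto simp: algebra_def)
  have diag: "((x, x), (y, y)) \<in> ?M" if "(x, y) \<in> \<alpha>" for x y
    using that x0 Con_refl[OF \<beta>]
    by (intro term_matricesI[where t = "Var (Inl 0)" and a = "\<lambda>_. x" and b = "\<lambda>_. y"
          and c = "\<lambda>_. x0" and d = "\<lambda>_. x0"]) auto
  have "?M\<^sup>+ \<in> Con ar (pair_alg B \<beta>)"
  proof (rule Con_trancl[OF pair_alg_algebra[OF B \<beta>]])
    show "?M \<subseteq> Nabla (pair_alg B \<beta>)"
      using M_subset Con_subset_Nabla[OF diag_con_in_Con[OF B \<beta>]] by (rule order_trans)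
    show "(p, p) \<in> ?M" if "p \<in> carrier (pair_alg B \<beta>)" for p
      using that x0 Con_refl[OF \<alpha>]
      by (intro term_matricesI[where t = "Var (Inr 0)" and a = "\<lambda>_. x0" and b = "\<lambda>_. x0"
            and c = "\<lambda>_. fst p" and d = "\<lambda>_. snd p"]) auto
    show "(q, p) \<in> ?M" if "(p, q) \<in> ?M" for p q
      using that Con_sym[OF \<alpha>] unfolding term_matrices_def by blast
    show "(ops (pair_alg B \<beta>) f ps, ops (pair_alg B \<beta>) f (ps[i := q])) \<in> ?M"
      if "length ps = ar f" "set ps \<subseteq> carrier (pair_alg B \<beta>)" "i < length ps" "(ps ! i, q) \<in> ?M"
      for f ps i q
      using that by (intro term_matrices_ops_update) simp_all
  qed
  then show "diag_con ar B \<beta> \<alpha> \<subseteq> ?M\<^sup>+"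
    by (rule diag_con_least) (rule r_into_trancl[OF diag])
qed

lemma centralizes_iff_diag_con:
  fixes B :: "('a, 'f) alg"
  assumes "algebra ar B" and "\<alpha> \<in> Con ar B" and "\<beta> \<in> Con ar B"
  shows "centralizes ar B \<alpha> \<beta> \<delta> \<longleftrightarrow> (\<forall>(p, q) \<in> diag_con ar B \<beta> \<alpha>. p \<in> \<delta> \<longrightarrow> q \<in> \<delta>)"
proof -
  have "q \<in> \<delta>" if closed: "\<forall>(p, q) \<in> R. p \<in> \<delta> \<longrightarrow> q \<in> \<delta>" and "(p, q) \<in> R\<^sup>+" "p \<in> \<delta>"
    for R :: "(('a \<times> 'a) \<times> 'a \<times> 'a) set" and p q
    using that(2,3) closed by (induction rule: trancl_induct) auto
  then show ?thesis
    unfolding centralizes_iff_term_matrices diag_con_eq_trancl_term_matrices[OF assms] by fast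
qed

lemma centralizes_diag_conD:
  assumes "algebra ar B" "\<alpha> \<in> Con ar B" "\<beta> \<in> Con ar B" "centralizes ar B \<alpha> \<beta> \<delta>"
    and "(p, q) \<in> diag_con ar B \<beta> \<alpha>" and "p \<in> \<delta>"
  shows "q \<in> \<delta>"
  using assms centralizes_iff_diag_con[OF assms(1-3)] by fast

lemma centralizes_Int:
  assumes B: "algebra ar B" and \<alpha>: "\<alpha> \<in> Con ar B" and \<beta>: "\<beta> \<in> Con ar B"
  shows "centralizes ar B \<alpha> \<beta> (\<alpha> \<inter> \<beta>)"
  unfolding centralizes_iff_diag_con[OF assms]
proof clarify
  fix x y z u assume D: "((x, y), (z, u)) \<in> diag_con ar B \<beta> \<alpha>" and xy: "(x, y) \<in> \<alpha>" "(x, y) \<in> \<beta>"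
  show "(z, u) \<in> \<alpha> \<inter> \<beta>"
    using diag_con_coordinates[OF assms D] diag_con_rows[OF B \<beta> D] xy(1)
    by (meson Con_sym[OF \<alpha>] Con_trans[OF \<alpha>] IntI)
qed

lemma centralizes_of_subset:
  assumes B: "algebra ar B" and \<alpha>: "\<alpha> \<in> Con ar B" and \<beta>: "\<beta> \<in> Con ar B" and \<delta>: "\<delta> \<in> Con ar B"
    and "\<alpha> \<subseteq> \<delta>"
  shows "centralizes ar B \<alpha> \<beta> \<delta>"
  unfolding centralizes_iff_diag_con[OF B \<alpha> \<beta>]
proof clarify
  fix x y z u assume D: "((x, y), (z, u)) \<in> diag_con ar B \<beta> \<alpha>" and "(x, y) \<in> \<delta>"
  then show "(z, u) \<in> \<delta>"
    using diag_con_coordinates[OF B \<alpha> \<beta> D] \<open>\<alpha> \<subseteq> \<delta>\<close> by (meson Con_sym[OF \<delta>] Con_trans[OF \<delta>] subsetD)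
qed

lemma centralizes_antimono:
  "centralizes ar B \<alpha> \<beta> \<delta> \<Longrightarrow> \<alpha>' \<subseteq> \<alpha> \<Longrightarrow> \<beta>' \<subseteq> \<beta> \<Longrightarrow> centralizes ar B \<alpha>' \<beta>' \<delta>"
  unfolding centralizes_def by blast

lemma centralizes_join:
  assumes B: "algebra ar B" and \<alpha>: "\<alpha> \<in> Con ar B" and \<alpha>': "\<alpha>' \<in> Con ar B" and \<beta>: "\<beta> \<in> Con ar B"
    and cent: "centralizes ar B \<alpha> \<beta> \<delta>" "centralizes ar B \<alpha>' \<beta> \<delta>"
  shows "centralizes ar B (join ar B \<alpha> \<alpha>') \<beta> \<delta>"
  unfolding centralizes_iff_diag_con[OF B join_in_Con[OF B] \<beta>]
proof clarify
  note D = diag_con_in_Con[OF B \<beta>]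
  fix x y z u assume "((x, y), (z, u)) \<in> diag_con ar B \<beta> (join ar B \<alpha> \<alpha>')" and xy: "(x, y) \<in> \<delta>"
  then have "((x, y), (z, u)) \<in> (diag_con ar B \<beta> \<alpha> \<union> diag_con ar B \<beta> \<alpha>')\<^sup>+"
    using diag_con_join_subset[OF B \<alpha> \<alpha>' \<beta>] join_eq_trancl[OF pair_alg_algebra[OF B \<beta>] D D] by blast
  then show "(z, u) \<in> \<delta>"
    by (induction rule: trancl_induct)
      (use xy centralizes_diag_conD[OF B \<alpha> \<beta> cent(1)] centralizes_diag_conD[OF B \<alpha>' \<beta> cent(2)]
        in blast)+
qed

context
  fixes ar :: "'f \<Rightarrow> nat" and B :: "('a, 'f) alg" and \<alpha> \<beta> \<delta>
  assumes B: "algebra ar B" and \<alpha>: "\<alpha> \<in> Con ar B" and \<beta>: "\<beta> \<in> Con ar B" and \<delta>: "\<delta> \<in> Con ar B"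
    and modular: "modular_Con ar (pair_alg B \<beta>)" and cent: "centralizes ar B \<alpha> \<beta> \<delta>"
begin

lemma diag_con_common_snd:
  assumes D: "((x, w), (y, w)) \<in> diag_con ar B \<beta> \<alpha>"
  shows "(x, y) \<in> \<delta>"
proof -
  let ?P = "pair_alg B \<beta>"
  note P = pair_alg_algebra[OF B \<beta>] and DC = diag_con_in_Con[OF B \<beta>, of \<alpha>]
  note kernels = vimage_snd_in_Con[OF B \<beta> Delta_in_Con[OF B]]
    vimage_fst_in_Con[OF B \<beta> Delta_in_Con[OF B]]
  have "(x, w) \<in> \<beta>" "(y, w) \<in> \<beta>" using diag_con_rows[OF B \<beta> D] by simp_all
  then have rows: "(x, w) \<in> \<beta>" "(y, w) \<in> \<beta>" "(x, y) \<in> \<beta>" "(y, y) \<in> \<beta>"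
    using Con_sym[OF \<beta>] Con_trans[OF \<beta>] by blast+
  then have carrier: "x \<in> carrier B" "y \<in> carrier B" "w \<in> carrier B" using Con_carrier[OF \<beta>] by auto
  have "((x, y), (y, y)) \<in> diag_con ar B \<beta> \<alpha>"
  proof (rule modular_shift[OF P modular kernels DC])
    show "vimage_con snd ?P (Delta B) \<inter> vimage_con fst ?P (Delta B) \<subseteq> diag_con ar B \<beta> \<alpha>"
      using Con_refl[OF DC] by (auto simp: in_vimage_con Delta_def)
    show "((x, w), (y, w)) \<in> diag_con ar B \<beta> \<alpha>" by (rule D)
  qed (use rows carrier in \<open>auto simp: in_vimage_con Delta_def\<close>)
  then have "((y, y), (x, y)) \<in> diag_con ar B \<beta> \<alpha>" by (rule Con_sym[OF DC])
  then show ?thesis using centralizes_diag_conD[OF B \<alpha> \<beta> cent] Con_refl[OF \<delta> carrier(2)] by blast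
qed

lemma diag_con_common_fst:
  assumes "((w, x), (w, y)) \<in> diag_con ar B \<beta> \<alpha>"
  shows "(x, y) \<in> \<delta>"
  by (rule diag_con_common_snd[OF diag_con_swap[OF B \<alpha> \<beta> assms]])

lemma centralizes_mono:
  assumes \<delta>': "\<delta>' \<in> Con ar B" and "\<delta> \<subseteq> \<delta>'"
  shows "centralizes ar B \<alpha> \<beta> \<delta>'"
  unfolding centralizes_iff_diag_con[OF B \<alpha> \<beta>]
proof clarify
  let ?P = "pair_alg B \<beta>" and ?D = "diag_con ar B \<beta> \<alpha>"
  note P = pair_alg_algebra[OF B \<beta>] and D = diag_con_in_Con[OF B \<beta>, of \<alpha>]
  fix x y z u assume xyzu: "((x, y), (z, u)) \<in> ?D" and xy: "(x, y) \<in> \<delta>'"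
  note rows = diag_con_rows[OF B \<beta> xyzu]
  then have carrier: "x \<in> carrier B" "y \<in> carrier B" "z \<in> carrier B" "u \<in> carrier B"
    using Con_carrier[OF \<beta>] by auto
  have "((y, y), (u, u)) \<in> ?D"
    using diagonal_in_diag_con[OF \<beta> \<alpha>] diag_con_coordinates[OF B \<alpha> \<beta> xyzu] by blast
  then have uy: "((u, u), (y, y)) \<in> ?D" by (rule Con_sym[OF D])
  have "((z, u), (u, u)) \<in> vimage_con fst ?P \<delta>'"
  proof (rule modular_shift[OF P modular vimage_snd_in_Con[OF B \<beta> Delta_in_Con[OF B]] D
        vimage_fst_in_Con[OF B \<beta> \<delta>']])
    show "vimage_con snd ?P (Delta B) \<inter> ?D \<subseteq> vimage_con fst ?P \<delta>'"
      using diag_con_common_snd \<open>\<delta> \<subseteq> \<delta>'\<close> by (fastforce simp: in_vimage_con Delta_def)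
    show "((z, u), (x, y)) \<in> ?D" using xyzu by (rule Con_sym[OF D])
    show "((x, y), (y, y)) \<in> vimage_con fst ?P \<delta>'"
      using xy rows carrier Con_refl[OF \<beta>] by (simp add: in_vimage_con)
  qed (use rows carrier Con_refl[OF \<beta>] uy in \<open>auto simp: in_vimage_con Delta_def\<close>)
  then show "(z, u) \<in> \<delta>'" by (simp add: in_vimage_con)
qed

lemma centralizes_sym: "centralizes ar B \<beta> \<alpha> \<delta>"
  unfolding centralizes_iff_term_matrices
proof clarify
  let ?P = "pair_alg B \<beta>" and ?D = "diag_con ar B \<beta> \<alpha>"
  note P = pair_alg_algebra[OF B \<beta>] and D = diag_con_in_Con[OF B \<beta>, of \<alpha>]
  fix x y z u assume M: "((x, z), (y, u)) \<in> term_matrices ar B \<beta> \<alpha>" and xz: "(x, z) \<in> \<delta>"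
  have xyzu: "((x, y), (z, u)) \<in> ?D"
    using term_matrices_transpose[OF M] term_matrices_subset_diag_con[OF B \<alpha> \<beta>] by blast
  note rows = diag_con_rows[OF B \<beta> xyzu]
  then have carrier: "x \<in> carrier B" "y \<in> carrier B" "z \<in> carrier B" "u \<in> carrier B"
    using Con_carrier[OF \<beta>] by auto
  have "((x, y), (z, u)) \<in> vimage_con snd ?P \<delta>"
  proof (rule modular_shift[OF P modular D vimage_fst_in_Con[OF B \<beta> Delta_in_Con[OF B]]
        vimage_snd_in_Con[OF B \<beta> \<delta>]])
    show "?D \<inter> vimage_con fst ?P (Delta B) \<subseteq> vimage_con snd ?P \<delta>"
      using diag_con_common_fst by (auto simp: in_vimage_con Delta_def)
    show "((x, x), (z, z)) \<in> ?D"
      using diagonal_in_diag_con[OF \<beta> \<alpha>] diag_con_coordinates[OF B \<alpha> \<beta> xyzu] by blast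
    show "((x, x), (z, z)) \<in> vimage_con snd ?P \<delta>"
      using xz carrier Con_refl[OF \<beta>] by (simp add: in_vimage_con)
  qed (use rows carrier Con_refl[OF \<beta>] xyzu in \<open>auto simp: in_vimage_con Delta_def\<close>)
  then show "(y, u) \<in> \<delta>" by (simp add: in_vimage_con)
qed

end

section \<open>Prime congruences and the commutator\<close>

lemma comm_in_Con: "algebra ar B \<Longrightarrow> comm ar B \<alpha> \<beta> \<in> Con ar B"
  unfolding comm_def by (rule Nabla_Inter_in_Con) auto

lemma comm_least: "\<delta> \<in> Con ar B \<Longrightarrow> centralizes ar B \<alpha> \<beta> \<delta> \<Longrightarrow> comm ar B \<alpha> \<beta> \<subseteq> \<delta>"
  unfolding comm_def by blast

lemma centralizes_comm:
  assumes B: "algebra ar B" and \<alpha>: "\<alpha> \<in> Con ar B" and \<beta>: "\<beta> \<in> Con ar B"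
  shows "centralizes ar B \<alpha> \<beta> (comm ar B \<alpha> \<beta>)"
proof -
  have "centralizes ar B \<alpha> \<beta> (Nabla B)"
    by (rule centralizes_of_subset[OF B \<alpha> \<beta> Nabla_in_Con[OF B] Con_subset_Nabla[OF \<alpha>]])
  then show ?thesis
    unfolding centralizes_iff_term_matrices comm_def by fast
qed

lemma comm_subset_Int:
  assumes "algebra ar B" "\<alpha> \<in> Con ar B" "\<beta> \<in> Con ar B"
  shows "comm ar B \<alpha> \<beta> \<subseteq> \<alpha> \<inter> \<beta>"
  using assms by (intro comm_least centralizes_Int Int_in_Con)

lemma prime_in_Con: "prime_con ar B \<phi> \<Longrightarrow> \<phi> \<in> Con ar B"
  by (simp add: prime_con_def)

lemma prime_comm: "prime_con ar B \<phi> \<Longrightarrow> \<alpha> \<in> Con ar B \<Longrightarrow> \<beta> \<in> Con ar B \<Longrightarrow> comm ar B \<alpha> \<beta> \<subseteq> \<phi>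
    \<Longrightarrow> \<alpha> \<subseteq> \<phi> \<or> \<beta> \<subseteq> \<phi>"
  by (simp add: prime_con_def)

lemma prime_Int:
  assumes "algebra ar B" "prime_con ar B \<phi>" "\<alpha> \<in> Con ar B" "\<beta> \<in> Con ar B" "\<alpha> \<inter> \<beta> \<subseteq> \<phi>"
  shows "\<alpha> \<subseteq> \<phi> \<or> \<beta> \<subseteq> \<phi>"
  using assms comm_subset_Int[OF assms(1,3,4)] by (intro prime_comm) auto

lemma rho_in_Con: "algebra ar B \<Longrightarrow> rho ar B \<theta> \<in> Con ar B"
  unfolding rho_def by (rule Nabla_Inter_in_Con) (auto simp: prime_con_def)

lemma subset_rho: "\<theta> \<in> Con ar B \<Longrightarrow> \<theta> \<subseteq> rho ar B \<theta>"
  using Con_subset_Nabla[of \<theta> ar B] by (auto simp: rho_def)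

lemma rho_subset_prime: "prime_con ar B \<phi> \<Longrightarrow> \<theta> \<subseteq> \<phi> \<Longrightarrow> rho ar B \<theta> \<subseteq> \<phi>"
  by (auto simp: rho_def)

lemma subset_rhoI:
  "\<alpha> \<in> Con ar B \<Longrightarrow> (\<And>\<phi>. prime_con ar B \<phi> \<Longrightarrow> \<theta> \<subseteq> \<phi> \<Longrightarrow> \<alpha> \<subseteq> \<phi>) \<Longrightarrow> \<alpha> \<subseteq> rho ar B \<theta>"
  using Con_subset_Nabla[of \<alpha> ar B] by (auto simp: rho_def)

lemma rho_least:
  assumes "algebra ar B" and "\<alpha> \<subseteq> rho ar B \<beta>"
  shows "rho ar B \<alpha> \<subseteq> rho ar B \<beta>"
  using assms(2) by (intro subset_rhoI rho_in_Con[OF assms(1)]) (meson order_trans rho_subset_prime)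

lemma rho_mono: "\<alpha> \<subseteq> \<beta> \<Longrightarrow> rho ar B \<alpha> \<subseteq> rho ar B \<beta>"
  by (auto simp: rho_def)

lemma rho_join_rho:
  assumes B: "algebra ar B" and \<alpha>: "\<alpha> \<in> Con ar B" and \<theta>: "\<theta> \<in> Con ar B"
  shows "rho ar B (join ar B \<alpha> (rho ar B \<theta>)) = rho ar B (join ar B \<alpha> \<theta>)"
proof
  note \<rho> = rho_in_Con[OF B] and J = join_in_Con[OF B]
  have "\<alpha> \<subseteq> rho ar B (join ar B \<alpha> \<theta>)" using join_ge1[OF \<alpha> \<theta>] subset_rho[OF J] by blast
  moreover have "rho ar B \<theta> \<subseteq> rho ar B (join ar B \<alpha> \<theta>)" by (rule rho_mono[OF join_ge2[OF \<alpha> \<theta>]])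
  ultimately show "rho ar B (join ar B \<alpha> (rho ar B \<theta>)) \<subseteq> rho ar B (join ar B \<alpha> \<theta>)"
    by (rule rho_least[OF B join_least[OF \<rho>]])
  show "rho ar B (join ar B \<alpha> \<theta>) \<subseteq> rho ar B (join ar B \<alpha> (rho ar B \<theta>))"
    using join_ge1[OF \<alpha> \<rho>] join_ge2[OF \<alpha> \<rho>] subset_rho[OF \<theta>] by (intro rho_mono join_least J) blast+
qed

section \<open>Complements over a congruence\<close>

definition complementary_over ::
  "('f \<Rightarrow> nat) \<Rightarrow> ('a, 'f) alg \<Rightarrow> ('a \<times> 'a) set \<Rightarrow> ('a \<times> 'a) set \<Rightarrow> ('a \<times> 'a) set \<Rightarrow> bool" where
  "complementary_over ar B \<theta> \<chi> \<chi>' \<longleftrightarrow>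
     \<chi> \<in> Con ar B \<and> \<chi>' \<in> Con ar B \<and> \<chi> \<inter> \<chi>' = \<theta> \<and> join ar B \<chi> \<chi>' = Nabla B"

lemma BoolCon_iff_complementary_over:
  "\<alpha> \<in> BoolCon ar B \<longleftrightarrow> (\<exists>\<alpha>'. complementary_over ar B (Delta B) \<alpha> \<alpha>')"
  by (auto simp: BoolCon_def complementary_over_def)

lemma BoolCon_in_Con: "\<alpha> \<in> BoolCon ar B \<Longrightarrow> \<alpha> \<in> Con ar B"
  by (simp add: BoolCon_def)

lemma prime_not_above_both:
  assumes "prime_con ar B \<phi>" and "join ar B \<alpha> \<beta> = Nabla B"
  shows "\<not> (\<alpha> \<subseteq> \<phi> \<and> \<beta> \<subseteq> \<phi>)"
  using join_least[OF prime_in_Con[OF assms(1)], of \<alpha> \<beta>] assms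
    Con_subset_Nabla[OF prime_in_Con[OF assms(1)]]
  by (auto simp: prime_con_def)

lemma complementary_over_rho:
  assumes B: "algebra ar B" and compl: "complementary_over ar B \<theta> \<chi> \<chi>'"
  shows "complementary_over ar B (rho ar B \<theta>)
    (join ar B \<chi> (rho ar B \<theta>)) (join ar B \<chi>' (rho ar B \<theta>))"
proof -
  let ?\<rho> = "rho ar B \<theta>"
  let ?X = "join ar B \<chi> ?\<rho>" and ?X' = "join ar B \<chi>' ?\<rho>"
  have \<chi>: "\<chi> \<in> Con ar B" "\<chi>' \<in> Con ar B" and bot: "\<chi> \<inter> \<chi>' = \<theta>" and top: "join ar B \<chi> \<chi>' = Nabla B"
    using compl by (simp_all add: complementary_over_def)
  note \<rho> = rho_in_Con[OF B, of \<theta>] and J = join_in_Con[OF B]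
  have "?X \<inter> ?X' \<subseteq> ?\<rho>"
  proof (rule subset_rhoI[OF Int_in_Con[OF B J J]])
    fix \<phi> assume \<phi>: "prime_con ar B \<phi>" "\<theta> \<subseteq> \<phi>"
    then have "\<chi> \<subseteq> \<phi> \<or> \<chi>' \<subseteq> \<phi>" using prime_Int[OF B \<phi>(1) \<chi>] bot by simp
    then show "?X \<inter> ?X' \<subseteq> \<phi>"
      using join_least[OF prime_in_Con[OF \<phi>(1)]] rho_subset_prime[OF \<phi>] by blast
  qed
  moreover have "?\<rho> \<subseteq> ?X" "?\<rho> \<subseteq> ?X'" by (rule join_ge2[OF _ \<rho>], rule \<chi>)+
  moreover have "join ar B \<chi> \<chi>' \<subseteq> join ar B ?X ?X'"
    using join_ge1[OF \<chi>(1) \<rho>] join_ge1[OF \<chi>(2) \<rho>] join_ge1[OF J J] join_ge2[OF J J]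
    by (intro join_least J) blast+
  ultimately show ?thesis
    using top Con_subset_Nabla[OF J] J by (simp add: complementary_over_def subset_antisym)
qed

lemma BoolCon_of_complementary_over_rho:
  assumes B: "algebra ar B" and compact: "Nabla B \<in> K ar B" and ret: "ret_preserves_bool ar B"
    and compl: "complementary_over ar B (rho ar B (Delta B)) \<chi> \<chi>'"
  obtains \<gamma> where "\<gamma> \<in> BoolCon ar B" "rho ar B \<gamma> = rho ar B \<chi>"
proof -
  have \<chi>: "\<chi> \<in> Con ar B" "\<chi>' \<in> Con ar B" and bot: "\<chi> \<inter> \<chi>' = rho ar B (Delta B)"
    and top: "join ar B \<chi> \<chi>' = Nabla B"
    using compl by (simp_all add: complementary_over_def)
  obtain \<kappa> \<kappa>' where \<kappa>: "\<kappa> \<in> K ar B" "\<kappa>' \<in> K ar B" "\<kappa> \<subseteq> \<chi>" "\<kappa>' \<subseteq> \<chi>'" "join ar B \<kappa> \<kappa>' = Nabla B"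
    by (rule compact_parts_of_join_Nabla[OF B compact \<chi> top])
  note \<kappa>C = \<kappa>(1,2)[THEN K_in_Con]
  have "comm ar B \<kappa> \<kappa>' \<subseteq> rho ar B (Delta B)"
    using comm_subset_Int[OF B \<kappa>C] \<kappa>(3,4) bot by blast
  then have "rho ar B (comm ar B \<kappa> \<kappa>') = rho ar B (Delta B)"
    using Delta_subset_Con[OF comm_in_Con[OF B]] by (intro equalityI rho_least[OF B] rho_mono)
  then have "ret_bool ar B \<kappa>" using \<kappa> unfolding ret_bool_def by metis
  then obtain \<gamma> where \<gamma>: "\<gamma> \<in> BoolCon ar B" "rho ar B \<gamma> = rho ar B \<kappa>"
    using ret unfolding ret_preserves_bool_def by blast
  have "\<chi> \<subseteq> rho ar B \<kappa>"
  proof (rule subset_rhoI[OF \<chi>(1)])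
    fix \<phi> assume \<phi>: "prime_con ar B \<phi>" "\<kappa> \<subseteq> \<phi>"
    then have "\<not> \<kappa>' \<subseteq> \<phi>" using prime_not_above_both[OF \<phi>(1) \<kappa>(5)] by blast
    moreover have "\<chi> \<inter> \<chi>' \<subseteq> \<phi>"
      unfolding bot by (rule rho_subset_prime[OF \<phi>(1) Delta_subset_Con[OF prime_in_Con[OF \<phi>(1)]]])
    ultimately show "\<chi> \<subseteq> \<phi>" using prime_Int[OF B \<phi>(1) \<chi>] \<kappa>(4) by blast
  qed
  then have "rho ar B \<chi> = rho ar B \<kappa>" by (intro equalityI rho_least[OF B] rho_mono \<kappa>(3))
  then show ?thesis using \<gamma> that by simp
qed

context epimorphism
begin

lemma hom_eval_case_sum:
  assumes t: "wf_term ar t" and "range e \<subseteq> carrier B" "range e' \<subseteq> carrier B"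
  shows "h (eval B (case_sum e e') t) = eval C (case_sum (h \<circ> e) (h \<circ> e')) t"
proof -
  have "case_sum e e' x \<in> carrier B" for x using assms(2,3) by (cases x) auto
  then show ?thesis
    using homomorphism_eval[OF algebra_domain homomorphism t, of "case_sum e e'"]
    by (auto simp: o_case_sum)
qed

lemma hom_term_matrix:
  fixes t :: "('f, nat + nat) term"
  assumes \<alpha>: "\<alpha> \<in> Con ar B" and \<beta>: "\<beta> \<in> Con ar B"
    and t: "wf_term ar t" and ab: "\<forall>i. (a i, b i) \<in> \<alpha>" and cd: "\<forall>j. (c j, d j) \<in> \<beta>"
  shows "map_prod h h (eval B (case_sum a c) t, eval B (case_sum a d) t)
      = (eval C (case_sum (h \<circ> a) (h \<circ> c)) t, eval C (case_sum (h \<circ> a) (h \<circ> d)) t)"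
    and "map_prod h h (eval B (case_sum b c) t, eval B (case_sum b d) t)
      = (eval C (case_sum (h \<circ> b) (h \<circ> c)) t, eval C (case_sum (h \<circ> b) (h \<circ> d)) t)"
proof -
  have "range a \<subseteq> carrier B" "range b \<subseteq> carrier B" "range c \<subseteq> carrier B" "range d \<subseteq> carrier B"
    using ab cd Con_carrier[OF \<alpha>] Con_carrier[OF \<beta>] by blast+
  note eval = hom_eval_case_sum[OF t this(1)] hom_eval_case_sum[OF t this(2)] this(3,4)
  show "map_prod h h (eval B (case_sum a c) t, eval B (case_sum a d) t)
      = (eval C (case_sum (h \<circ> a) (h \<circ> c)) t, eval C (case_sum (h \<circ> a) (h \<circ> d)) t)"
    and "map_prod h h (eval B (case_sum b c) t, eval B (case_sum b d) t)
      = (eval C (case_sum (h \<circ> b) (h \<circ> c)) t, eval C (case_sum (h \<circ> b) (h \<circ> d)) t)"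
    by (simp_all add: eval)
qed

lemma term_matrices_imageI:
  assumes \<alpha>: "\<alpha> \<in> Con ar B" and \<beta>: "\<beta> \<in> Con ar B" and "(p, q) \<in> term_matrices ar B \<alpha> \<beta>"
  shows "(map_prod h h p, map_prod h h q) \<in> term_matrices ar C (image_con h \<alpha>) (image_con h \<beta>)"
proof -
  obtain t :: "('f, nat + nat) term" and a b c d
    where t: "wf_term ar t" and ab: "\<forall>i. (a i, b i) \<in> \<alpha>" and cd: "\<forall>j. (c j, d j) \<in> \<beta>"
      and pq: "p = (eval B (case_sum a c) t, eval B (case_sum a d) t)"
        "q = (eval B (case_sum b c) t, eval B (case_sum b d) t)"
    using assms(3) by (blast elim: term_matricesE)
  show ?thesis
  proof (rule term_matricesI[OF t])
    show "((h \<circ> a) i, (h \<circ> b) i) \<in> image_con h \<alpha>" for i using ab by (force simp: image_con_def)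
    show "((h \<circ> c) j, (h \<circ> d) j) \<in> image_con h \<beta>" for j using cd by (force simp: image_con_def)
  qed (simp_all only: pq hom_term_matrix[OF \<alpha> \<beta> t ab cd])
qed

lemma term_matrices_imageE:
  assumes \<alpha>: "\<alpha> \<in> Con ar B" and \<beta>: "\<beta> \<in> Con ar B"
    and "(P, Q) \<in> term_matrices ar C (image_con h \<alpha>) (image_con h \<beta>)"
  obtains p q
  where "(p, q) \<in> term_matrices ar B \<alpha> \<beta>" "P = map_prod h h p" "Q = map_prod h h q"
proof -
  obtain t :: "('f, nat + nat) term" and a b c d
    where t: "wf_term ar t" and ab: "\<forall>i. (a i, b i) \<in> image_con h \<alpha>"
      and cd: "\<forall>j. (c j, d j) \<in> image_con h \<beta>"
      and PQ: "P = (eval C (case_sum a c) t, eval C (case_sum a d) t)"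
        "Q = (eval C (case_sum b c) t, eval C (case_sum b d) t)"
    using assms(3) by (blast elim: term_matricesE)
  have "\<forall>i. \<exists>x y. (x, y) \<in> \<alpha> \<and> a i = h x \<and> b i = h y"
    and "\<forall>j. \<exists>x y. (x, y) \<in> \<beta> \<and> c j = h x \<and> d j = h y"
    using ab cd by (force simp: image_con_def)+
  then obtain a' b' c' d' where rel: "\<forall>i. (a' i, b' i) \<in> \<alpha>" "\<forall>j. (c' j, d' j) \<in> \<beta>"
    and "a = h \<circ> a'" "b = h \<circ> b'" "c = h \<circ> c'" "d = h \<circ> d'"
    unfolding fun_eq_iff comp_def by metis
  then have "P = map_prod h h (eval B (case_sum a' c') t, eval B (case_sum a' d') t)"
    "Q = map_prod h h (eval B (case_sum b' c') t, eval B (case_sum b' d') t)"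
    using hom_term_matrix[OF \<alpha> \<beta> t rel] PQ by simp_all
  then show ?thesis using that term_matricesI[OF t] rel by blast
qed

lemma centralizes_vimage:
  assumes "\<alpha> \<in> Con ar C" and "\<beta> \<in> Con ar C" and cent: "centralizes ar C \<alpha> \<beta> \<delta>"
  shows "centralizes ar B (vimage_con h B \<alpha>) (vimage_con h B \<beta>) (vimage_con h B \<delta>)"
  unfolding centralizes_iff_term_matrices
proof clarify
  have Con: "vimage_con h B \<alpha> \<in> Con ar B" "vimage_con h B \<beta> \<in> Con ar B"
    using assms vimage_in_Con by simp_all
  fix x y z u
  assume M: "((x, y), (z, u)) \<in> term_matrices ar B (vimage_con h B \<alpha>) (vimage_con h B \<beta>)"
    and xy: "(x, y) \<in> vimage_con h B \<delta>"
  have "((h x, h y), (h z, h u)) \<in> term_matrices ar C \<alpha> \<beta>"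
    using term_matrices_imageI[OF Con M] assms by (simp add: image_vimage_con Con_subset_Nabla)
  then have "(h z, h u) \<in> \<delta>"
    using cent xy unfolding centralizes_iff_term_matrices in_vimage_con by fast
  moreover have "(z, u) \<in> vimage_con h B \<beta>"
    by (rule diag_con_rows(2)[OF algebra_domain Con(2)
          subsetD[OF term_matrices_subset_diag_con[OF algebra_domain Con] M]])
  ultimately show "(z, u) \<in> vimage_con h B \<delta>" by (simp add: in_vimage_con)
qed

lemma centralizes_image:
  assumes \<alpha>: "\<alpha> \<in> Con ar B" and \<beta>: "\<beta> \<in> Con ar B" and \<delta>: "\<delta> \<in> Con ar B" "kernel h B \<subseteq> \<delta>"
    and cent: "centralizes ar B \<alpha> \<beta> \<delta>"
  shows "centralizes ar C (image_con h \<alpha>) (image_con h \<beta>) (image_con h \<delta>)"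
proof -
  have "Q \<in> image_con h \<delta>"
    if M: "(P, Q) \<in> term_matrices ar C (image_con h \<alpha>) (image_con h \<beta>)" and P: "P \<in> image_con h \<delta>"
    for P Q
  proof -
    obtain p q where pq: "(p, q) \<in> term_matrices ar B \<alpha> \<beta>"
      and PQ: "P = map_prod h h p" "Q = map_prod h h q"
      by (rule term_matrices_imageE[OF \<alpha> \<beta> M])
    have "(p, q) \<in> diag_con ar B \<beta> \<alpha>"
      using term_matrices_subset_diag_con[OF algebra_domain \<alpha> \<beta>] pq by blast
    then have "p \<in> \<beta>" using Con_carrier(1)[OF diag_con_in_Con[OF algebra_domain \<beta>]] by fastforce
    then have "p \<in> carrier B \<times> carrier B" using Con_subset_Nabla[OF \<beta>] by (auto simp: Nabla_def)
    then have "p \<in> \<delta>" using P PQ(1) image_con_iff[OF \<delta>] by auto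
    then have "q \<in> \<delta>" using cent pq unfolding centralizes_iff_term_matrices by fast
    then show ?thesis unfolding PQ(2) image_con_def by (rule imageI)
  qed
  then show ?thesis unfolding centralizes_iff_term_matrices by fast
qed

lemma prime_of_prime_vimage:
  assumes \<phi>: "\<phi> \<in> Con ar C" and prime: "prime_con ar B (vimage_con h B \<phi>)"
  shows "prime_con ar C \<phi>"
  unfolding prime_con_def
proof (intro conjI ballI impI \<phi>)
  show "\<phi> \<noteq> Nabla C" using prime vimage_con_Nabla by (auto simp: prime_con_def)
  fix \<alpha> \<beta> assume \<alpha>: "\<alpha> \<in> Con ar C" and \<beta>: "\<beta> \<in> Con ar C" and comm_below: "comm ar C \<alpha> \<beta> \<subseteq> \<phi>"
  have "comm ar B (vimage_con h B \<alpha>) (vimage_con h B \<beta>) \<subseteq> vimage_con h B (comm ar C \<alpha> \<beta>)"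
    by (intro comm_least vimage_in_Con comm_in_Con centralizes_vimage centralizes_comm
        algebra_codomain \<alpha> \<beta>)
  also have "\<dots> \<subseteq> vimage_con h B \<phi>" by (rule vimage_con_mono[OF comm_below])
  finally have "vimage_con h B \<alpha> \<subseteq> vimage_con h B \<phi> \<or> vimage_con h B \<beta> \<subseteq> vimage_con h B \<phi>"
    by (rule prime_comm[OF prime vimage_in_Con[OF \<alpha>] vimage_in_Con[OF \<beta>]])
  then show "\<alpha> \<subseteq> \<phi> \<or> \<beta> \<subseteq> \<phi>"
    using \<alpha> \<beta> \<phi> by (simp add: vimage_con_subset_vimage_con_iff Con_subset_Nabla)
qed

lemma complementary_over_vimage_iff:
  assumes \<phi>: "\<phi> \<in> Con ar C" "\<phi>' \<in> Con ar C" and \<delta>: "\<delta> \<subseteq> Nabla C"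
  shows "complementary_over ar B (vimage_con h B \<delta>) (vimage_con h B \<phi>) (vimage_con h B \<phi>')
    \<longleftrightarrow> complementary_over ar C \<delta> \<phi> \<phi>'"
proof -
  have "\<phi> \<inter> \<phi>' \<subseteq> Nabla C" using Con_subset_Nabla[OF \<phi>(1)] by blast
  then have "vimage_con h B \<phi> \<inter> vimage_con h B \<phi>' = vimage_con h B \<delta> \<longleftrightarrow> \<phi> \<inter> \<phi>' = \<delta>"
    using vimage_con_inject[of "\<phi> \<inter> \<phi>'" \<delta>] \<delta> by (simp add: vimage_con_Int)
  moreover have "join ar B (vimage_con h B \<phi>) (vimage_con h B \<phi>') = Nabla B
      \<longleftrightarrow> join ar C \<phi> \<phi>' = Nabla C"
    using vimage_con_inject[of "join ar C \<phi> \<phi>'" "Nabla C"] \<phi>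
      Con_subset_Nabla[OF join_in_Con[OF algebra_codomain]]
    by (simp add: vimage_con_join vimage_con_Nabla)
  ultimately show ?thesis using \<phi> vimage_in_Con by (simp add: complementary_over_def)
qed

lemma complementary_over_image:
  assumes compl: "complementary_over ar B (vimage_con h B \<delta>) \<chi> \<chi>'" and \<delta>: "\<delta> \<in> Con ar C"
  shows "complementary_over ar C \<delta> (image_con h \<chi>) (image_con h \<chi>')"
    and "vimage_con h B (image_con h \<chi>) = \<chi>"
proof -
  have \<chi>: "\<chi> \<in> Con ar B" "\<chi>' \<in> Con ar B" and above: "kernel h B \<subseteq> \<chi>" "kernel h B \<subseteq> \<chi>'"
    using compl kernel_subset_vimage[OF \<delta>] by (auto simp: complementary_over_def)
  show "vimage_con h B (image_con h \<chi>) = \<chi>" by (rule vimage_image_con[OF \<chi>(1) above(1)])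
  show "complementary_over ar C \<delta> (image_con h \<chi>) (image_con h \<chi>')"
    using complementary_over_vimage_iff[of "image_con h \<chi>" "image_con h \<chi>'" \<delta>] compl
      Con_subset_Nabla[OF \<delta>] \<chi> above by (simp add: vimage_image_con image_in_Con)
qed

end

lemma CBLP_iff_complementary_over:
  assumes A: "algebra ar A" and \<theta>: "\<theta> \<in> Con ar A"
  shows "CBLP ar A \<theta> \<longleftrightarrow>
    (\<forall>\<chi> \<chi>'. complementary_over ar A \<theta> \<chi> \<chi>' \<longrightarrow> (\<exists>\<alpha>\<in>BoolCon ar A. join ar A \<alpha> \<theta> = \<chi>))"
proof -
  let ?h = "\<lambda>x. \<theta> `` {x}" and ?Q = "quot A \<theta>"
  interpret epimorphism ar A ?Q ?h by (rule epimorphism_quot[OF A \<theta>])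
  have Delta: "vimage_con ?h A (Delta ?Q) = \<theta>" by (simp add: vimage_con_Delta kernel_quot[OF \<theta>])
  have "image_con ?h (join ar A \<alpha> \<theta>) = \<beta> \<longleftrightarrow> join ar A \<alpha> \<theta> = vimage_con ?h A \<beta>"
    if "\<alpha> \<in> BoolCon ar A" and "\<beta> \<in> BoolCon ar ?Q" for \<alpha> \<beta>
    using that join_ge2[OF BoolCon_in_Con \<theta>]
    by (intro image_con_eq_iff join_in_Con A) (simp_all add: kernel_quot[OF \<theta>] BoolCon_in_Con)
  then have "CBLP ar A \<theta> \<longleftrightarrow>
    (\<forall>\<beta>\<in>BoolCon ar ?Q. \<exists>\<alpha>\<in>BoolCon ar A. join ar A \<alpha> \<theta> = vimage_con ?h A \<beta>)"
    by (simp add: CBLP_def quot_con_eq_image_con)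
  also have "\<dots> \<longleftrightarrow> (\<forall>\<chi> \<chi>'. complementary_over ar A \<theta> \<chi> \<chi>' \<longrightarrow> (\<exists>\<alpha>\<in>BoolCon ar A. join ar A \<alpha> \<theta> = \<chi>))"
  proof (intro iffI allI impI ballI)
    fix \<chi> \<chi>'
    assume lift: "\<forall>\<beta>\<in>BoolCon ar ?Q. \<exists>\<alpha>\<in>BoolCon ar A. join ar A \<alpha> \<theta> = vimage_con ?h A \<beta>"
      and "complementary_over ar A \<theta> \<chi> \<chi>'"
    then have "complementary_over ar A (vimage_con ?h A (Delta ?Q)) \<chi> \<chi>'" by (simp only: Delta)
    note image = complementary_over_image[OF this Delta_in_Con[OF algebra_codomain]]
    have "image_con ?h \<chi> \<in> BoolCon ar ?Q"
      unfolding BoolCon_iff_complementary_over using image(1) by blast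
    from lift[rule_format, OF this] show "\<exists>\<alpha>\<in>BoolCon ar A. join ar A \<alpha> \<theta> = \<chi>"
      unfolding image(2) .
  next
    fix \<beta>
    assume lift: "\<forall>\<chi> \<chi>'. complementary_over ar A \<theta> \<chi> \<chi>' \<longrightarrow> (\<exists>\<alpha>\<in>BoolCon ar A. join ar A \<alpha> \<theta> = \<chi>)"
      and "\<beta> \<in> BoolCon ar ?Q"
    then obtain \<beta>' where \<beta>': "complementary_over ar ?Q (Delta ?Q) \<beta> \<beta>'"
      by (auto simp: BoolCon_iff_complementary_over)
    then have "complementary_over ar A \<theta> (vimage_con ?h A \<beta>) (vimage_con ?h A \<beta>')"
      using complementary_over_vimage_iff[of \<beta> \<beta>' "Delta ?Q"]
        Con_subset_Nabla[OF Delta_in_Con[OF algebra_codomain]]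
      by (simp add: Delta complementary_over_def)
    then show "\<exists>\<alpha>\<in>BoolCon ar A. join ar A \<alpha> \<theta> = vimage_con ?h A \<beta>" using lift by blast
  qed
  finally show ?thesis .
qed

section \<open>Modular semidegenerate algebras\<close>

text \<open>Modularity is not required of \<open>pair_alg A \<nabla>\<close>: this algebra may be too large to have a copy on
the type \<open>'a set\<close>, which is where the standing assumption would provide it.\<close>

locale modular_semidegenerate_algebra =
  fixes ar :: "'f \<Rightarrow> nat" and A :: "('a, 'f) alg"
  assumes algebra: "algebra ar A"
    and Nabla_compact: "Nabla A \<in> K ar A"
    and modular_pair_alg: "\<beta> \<in> Con ar A \<Longrightarrow> \<beta> \<noteq> Nabla A \<Longrightarrow> modular_Con ar (pair_alg A \<beta>)"
    and diag_con_Nabla: "\<beta> \<in> Con ar A \<Longrightarrow> diag_con ar A \<beta> (Nabla A) = Nabla (pair_alg A \<beta>)"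
begin

lemma subset_of_centralizes_Nabla:
  assumes \<beta>: "\<beta> \<in> Con ar A" and \<delta>: "\<delta> \<in> Con ar A" and cent: "centralizes ar A (Nabla A) \<beta> \<delta>"
  shows "\<beta> \<subseteq> \<delta>"
proof clarify
  fix x y assume xy: "(x, y) \<in> \<beta>"
  then have x: "x \<in> carrier A" by (rule Con_carrier[OF \<beta>])
  have "((x, x), (x, y)) \<in> Nabla (pair_alg A \<beta>)"
    using xy Con_refl[OF \<beta> x] by (simp add: Nabla_def)
  then have "((x, x), (x, y)) \<in> diag_con ar A \<beta> (Nabla A)" by (simp only: diag_con_Nabla[OF \<beta>])
  then show "(x, y) \<in> \<delta>"
    by (rule centralizes_diag_conD[OF algebra Nabla_in_Con[OF algebra] \<beta> cent])
      (rule Con_refl[OF \<delta> x])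
qed

lemma primeI:
  assumes \<phi>: "\<phi> \<in> Con ar A" "\<phi> \<noteq> Nabla A"
    and step: "\<And>\<alpha> \<beta>. \<alpha> \<in> Con ar A \<Longrightarrow> \<beta> \<in> Con ar A \<Longrightarrow> \<alpha> \<noteq> Nabla A \<Longrightarrow> \<beta> \<noteq> Nabla A
      \<Longrightarrow> centralizes ar A \<alpha> \<beta> \<phi> \<Longrightarrow> \<alpha> \<subseteq> \<phi> \<or> \<beta> \<subseteq> \<phi>"
  shows "prime_con ar A \<phi>"
  unfolding prime_con_def
proof (intro conjI ballI impI \<phi>)
  fix \<alpha> \<beta>
  assume \<alpha>: "\<alpha> \<in> Con ar A" and \<beta>: "\<beta> \<in> Con ar A" and comm_below: "comm ar A \<alpha> \<beta> \<subseteq> \<phi>"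
  note cent = centralizes_comm[OF algebra \<alpha> \<beta>] and comm = comm_in_Con[OF algebra, of \<alpha> \<beta>]
  consider (left) "\<alpha> = Nabla A" | (right) "\<alpha> \<noteq> Nabla A" "\<beta> = Nabla A"
    | (proper) "\<alpha> \<noteq> Nabla A" "\<beta> \<noteq> Nabla A" by blast
  then show "\<alpha> \<subseteq> \<phi> \<or> \<beta> \<subseteq> \<phi>"
  proof cases
    case left
    then show ?thesis using subset_of_centralizes_Nabla[OF \<beta> comm] cent comm_below by blast
  next
    case right
    have "centralizes ar A \<alpha> \<alpha> (comm ar A \<alpha> \<beta>)"
      using cent by (rule centralizes_antimono) (use right Con_subset_Nabla[OF \<alpha>] in auto)
    from centralizes_mono[OF algebra \<alpha> \<alpha> comm modular_pair_alg[OF \<alpha> right(1)] this \<phi>(1) comm_below]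
    show ?thesis using step[OF \<alpha> \<alpha> right(1) right(1)] by blast
  next
    case proper
    from centralizes_mono[OF algebra \<alpha> \<beta> comm modular_pair_alg[OF \<beta> proper(2)] cent \<phi>(1) comm_below]
    show ?thesis using step[OF \<alpha> \<beta> proper] by blast
  qed
qed

lemma prime_above:
  assumes "\<tau> \<in> Con ar A" "\<tau> \<noteq> Nabla A"
  obtains \<phi> where "prime_con ar A \<phi>" "\<tau> \<subseteq> \<phi>"
proof -
  obtain M where M: "M \<in> Con ar A" "\<tau> \<subseteq> M" "M \<noteq> Nabla A"
    and maximal: "\<And>\<chi>. \<chi> \<in> Con ar A \<Longrightarrow> M \<subseteq> \<chi> \<Longrightarrow> \<chi> \<noteq> Nabla A \<Longrightarrow> \<chi> = M"
    by (rule maximal_Con_above[OF algebra Nabla_compact assms]) blast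
  have "prime_con ar A M"
  proof (rule primeI[OF M(1,3)])
    fix \<alpha> \<beta>
    assume \<alpha>: "\<alpha> \<in> Con ar A" and \<beta>: "\<beta> \<in> Con ar A" and cent: "centralizes ar A \<alpha> \<beta> M"
    show "\<alpha> \<subseteq> M \<or> \<beta> \<subseteq> M"
    proof (cases "\<alpha> \<subseteq> M")
      case False
      then have "join ar A \<alpha> M \<noteq> M" using join_ge1[OF \<alpha> M(1)] by blast
      then have "join ar A \<alpha> M = Nabla A"
        using maximal[OF join_in_Con[OF algebra] join_ge2[OF \<alpha> M(1)]] by blast
      moreover have "centralizes ar A (join ar A \<alpha> M) \<beta> M"
        by (intro centralizes_join centralizes_of_subset algebra \<alpha> \<beta> M cent order_refl)
      ultimately show ?thesis using subset_of_centralizes_Nabla[OF \<beta> M(1)] by simp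
    qed simp
  qed
  then show ?thesis using M(2) by (rule that)
qed

text \<open>Here distributivity enters: \<open>\<chi> = [\<nabla>, \<chi>] = [\<psi>, \<chi>] \<or> [\<chi>', \<chi>] \<subseteq> \<psi>\<close>.\<close>

lemma subset_of_join_Nabla:
  assumes \<psi>: "\<psi> \<in> Con ar A" and \<chi>: "\<chi> \<in> Con ar A" and \<chi>': "\<chi>' \<in> Con ar A"
    and top: "join ar A \<psi> \<chi>' = Nabla A" and Int_below: "\<chi> \<inter> \<chi>' \<subseteq> \<psi>"
  shows "\<chi> \<subseteq> \<psi>"
proof (cases "\<chi> = Nabla A")
  case True
  then have "\<chi>' \<subseteq> \<psi>" using Int_below Con_subset_Nabla[OF \<chi>'] by blast
  then show ?thesis using join_least[OF \<psi> order_refl] top Con_subset_Nabla[OF \<chi>] by blast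
next
  case False
  note \<delta> = Int_in_Con[OF algebra \<psi> \<chi>]
  have "centralizes ar A \<chi>' \<chi> (\<psi> \<inter> \<chi>)"
    by (rule centralizes_mono[OF algebra \<chi>' \<chi> Int_in_Con[OF algebra \<chi>' \<chi>]
          modular_pair_alg[OF \<chi> False] centralizes_Int[OF algebra \<chi>' \<chi>] \<delta>])
      (use Int_below in blast)
  from centralizes_join[OF algebra \<psi> \<chi>' \<chi> centralizes_Int[OF algebra \<psi> \<chi>] this] top
  show ?thesis using subset_of_centralizes_Nabla[OF \<chi> \<delta>] by simp
qed

lemma complemented_subset_rho_iff:
  assumes compl: "complementary_over ar A \<theta> \<chi> \<chi>'" and \<psi>: "\<psi> \<in> Con ar A" "\<theta> \<subseteq> \<psi>"
  shows "\<chi> \<subseteq> rho ar A \<psi> \<longleftrightarrow> \<chi> \<subseteq> \<psi>"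
proof
  have \<chi>: "\<chi> \<in> Con ar A" "\<chi>' \<in> Con ar A" and bot: "\<chi> \<inter> \<chi>' = \<theta>" and top: "join ar A \<chi> \<chi>' = Nabla A"
    using compl by (simp_all add: complementary_over_def)
  assume below_rho: "\<chi> \<subseteq> rho ar A \<psi>"
  have "join ar A \<psi> \<chi>' = Nabla A"
  proof (rule ccontr)
    assume "join ar A \<psi> \<chi>' \<noteq> Nabla A"
    then obtain \<phi> where \<phi>: "prime_con ar A \<phi>" "join ar A \<psi> \<chi>' \<subseteq> \<phi>"
      by (rule prime_above[OF join_in_Con[OF algebra]])
    then have "\<psi> \<subseteq> \<phi>" "\<chi>' \<subseteq> \<phi>" using join_ge1[OF \<psi>(1) \<chi>(2)] join_ge2[OF \<psi>(1) \<chi>(2)] by auto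
    then have "\<chi> \<subseteq> \<phi> \<and> \<chi>' \<subseteq> \<phi>" using below_rho rho_subset_prime[OF \<phi>(1)] by blast
    then show False using prime_not_above_both[OF \<phi>(1) top] by blast
  qed
  then show "\<chi> \<subseteq> \<psi>" by (rule subset_of_join_Nabla[OF \<psi>(1) \<chi>]) (use bot \<psi>(2) in simp)
qed (use subset_rho[OF \<psi>(1)] in blast)

lemma centralizes_join_both:
  assumes \<alpha>: "\<alpha> \<in> Con ar A" "\<alpha> \<noteq> Nabla A" and \<beta>: "\<beta> \<in> Con ar A" "\<beta> \<noteq> Nabla A"
    and \<theta>: "\<theta> \<in> Con ar A" and \<delta>: "\<delta> \<in> Con ar A" "\<theta> \<subseteq> \<delta>" and cent: "centralizes ar A \<alpha> \<beta> \<delta>"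
  shows "centralizes ar A (join ar A \<alpha> \<theta>) (join ar A \<beta> \<theta>) \<delta>"
proof -
  note J = join_in_Con[OF algebra]
  have absorb: "centralizes ar A (join ar A \<gamma> \<theta>) \<chi> \<delta>"
    if "\<gamma> \<in> Con ar A" "\<chi> \<in> Con ar A" "centralizes ar A \<gamma> \<chi> \<delta>" for \<gamma> \<chi>
    by (intro centralizes_join centralizes_of_subset algebra that \<theta> \<delta>)
  have "centralizes ar A \<beta> \<alpha> \<delta>"
    by (rule centralizes_sym[OF algebra \<alpha>(1) \<beta>(1) \<delta>(1) modular_pair_alg[OF \<beta>] cent])
  then have "centralizes ar A (join ar A \<beta> \<theta>) \<alpha> \<delta>" by (rule absorb[OF \<beta>(1) \<alpha>(1)])
  then have "centralizes ar A \<alpha> (join ar A \<beta> \<theta>) \<delta>"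
    by (rule centralizes_sym[OF algebra J \<alpha>(1) \<delta>(1) modular_pair_alg[OF \<alpha>]])
  then show ?thesis by (rule absorb[OF \<alpha>(1) J])
qed

lemma prime_vimage:
  assumes epi: "epimorphism ar A C h" and prime: "prime_con ar C \<phi>"
  shows "prime_con ar A (vimage_con h A \<phi>)"
proof -
  interpret epimorphism ar A C h by (rule epi)
  have \<phi>: "\<phi> \<in> Con ar C" "\<phi> \<noteq> Nabla C" using prime by (auto simp: prime_con_def)
  let ?\<theta> = "kernel h A" and ?\<phi> = "vimage_con h A \<phi>"
  note vimage = vimage_in_Con[OF \<phi>(1)] and ker = kernel_subset_vimage[OF \<phi>(1)]
  have \<theta>: "?\<theta> \<in> Con ar A"
    using vimage_in_Con[OF Delta_in_Con[OF algebra_codomain]] by (simp add: vimage_con_Delta)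
  show ?thesis
  proof (rule primeI[OF vimage])
    show "?\<phi> \<noteq> Nabla A"
      using vimage_con_inject[of \<phi> "Nabla C"] Con_subset_Nabla[OF \<phi>(1)] \<phi>(2)
      by (simp add: vimage_con_Nabla)
    fix \<alpha> \<beta>
    assume \<alpha>: "\<alpha> \<in> Con ar A" "\<alpha> \<noteq> Nabla A" and \<beta>: "\<beta> \<in> Con ar A" "\<beta> \<noteq> Nabla A"
      and cent: "centralizes ar A \<alpha> \<beta> ?\<phi>"
    let ?a = "join ar A \<alpha> ?\<theta>" and ?b = "join ar A \<beta> ?\<theta>"
    note J = join_in_Con[OF algebra]
    from centralizes_image[OF J J vimage ker centralizes_join_both[OF \<alpha> \<beta> \<theta> vimage ker cent]]
    have "comm ar C (image_con h ?a) (image_con h ?b) \<subseteq> \<phi>"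
      by (intro comm_least \<phi>) (simp add: image_vimage_con Con_subset_Nabla[OF \<phi>(1)])
    moreover have above: "?\<theta> \<subseteq> ?a" "?\<theta> \<subseteq> ?b" using join_ge2[OF _ \<theta>] \<alpha>(1) \<beta>(1) by auto
    ultimately have "image_con h ?a \<subseteq> \<phi> \<or> image_con h ?b \<subseteq> \<phi>"
      by (intro prime_comm[OF prime] image_in_Con J) simp_all
    then have "?a \<subseteq> ?\<phi> \<or> ?b \<subseteq> ?\<phi>"
      using vimage_con_mono[of _ \<phi> h A] vimage_image_con[OF J above(1)]
        vimage_image_con[OF J above(2)] by metis
    then show "\<alpha> \<subseteq> ?\<phi> \<or> \<beta> \<subseteq> ?\<phi>" using join_ge1[OF \<alpha>(1) \<theta>] join_ge1[OF \<beta>(1) \<theta>] by blast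
  qed
qed

lemma rho_vimage:
  assumes epi: "epimorphism ar A C h" and \<phi>: "\<phi> \<in> Con ar C"
  shows "rho ar A (vimage_con h A \<phi>) = vimage_con h A (rho ar C \<phi>)"
proof
  interpret epimorphism ar A C h by (rule epi)
  note \<rho> = rho_in_Con[OF algebra_codomain]
  show "rho ar A (vimage_con h A \<phi>) \<subseteq> vimage_con h A (rho ar C \<phi>)"
  proof (rule subrelI)
    fix x y assume xy: "(x, y) \<in> rho ar A (vimage_con h A \<phi>)"
    then have carrier: "x \<in> carrier A" "y \<in> carrier A" by (auto simp: rho_def Nabla_def)
    have "(h x, h y) \<in> \<psi>" if "prime_con ar C \<psi>" "\<phi> \<subseteq> \<psi>" for \<psi>
      using xy rho_subset_prime[OF prime_vimage[OF epi that(1)] vimage_con_mono[OF that(2)]]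
      by (auto simp: in_vimage_con)
    moreover have "(h x, h y) \<in> Nabla C"
      using carrier by (auto simp: Nabla_def simp flip: image_carrier)
    ultimately show "(x, y) \<in> vimage_con h A (rho ar C \<phi>)"
      using carrier by (simp add: in_vimage_con rho_def)
  qed
  show "vimage_con h A (rho ar C \<phi>) \<subseteq> rho ar A (vimage_con h A \<phi>)"
  proof (rule subset_rhoI[OF vimage_in_Con[OF \<rho>]])
    fix \<psi> assume \<psi>: "prime_con ar A \<psi>" and above: "vimage_con h A \<phi> \<subseteq> \<psi>"
    have ker: "kernel h A \<subseteq> \<psi>" using kernel_subset_vimage[OF \<phi>] above by simp
    note image = image_in_Con[OF prime_in_Con[OF \<psi>] ker] vimage_image_con[OF prime_in_Con[OF \<psi>] ker]
    have "prime_con ar C (image_con h \<psi>)"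
      by (rule prime_of_prime_vimage[OF image(1)]) (simp add: image(2) \<psi>)
    then have "rho ar C \<phi> \<subseteq> image_con h \<psi>"
      using above vimage_con_subset_iff[OF \<phi> prime_in_Con[OF \<psi>] ker]
      by (intro rho_subset_prime) simp_all
    then show "vimage_con h A (rho ar C \<phi>) \<subseteq> \<psi>"
      using vimage_con_subset_iff[OF \<rho> prime_in_Con[OF \<psi>] ker] by simp
  qed
qed

lemma complementary_over_rho_lift:
  assumes \<theta>: "\<theta> \<in> Con ar A" and ret: "ret_preserves_bool ar (quot A \<theta>)"
    and compl: "complementary_over ar A (rho ar A \<theta>) \<chi> \<chi>'"
  obtains \<psi> \<psi>' where "complementary_over ar A \<theta> \<psi> \<psi>'" "rho ar A \<psi> = rho ar A \<chi>"
proof -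
  let ?Q = "quot A \<theta>" and ?h = "\<lambda>x. \<theta> `` {x}"
  note epi = epimorphism_quot[OF algebra \<theta>]
  interpret epimorphism ar A ?Q ?h by (rule epi)
  note Q = algebra_codomain
  have Delta: "vimage_con ?h A (Delta ?Q) = \<theta>" by (simp add: vimage_con_Delta kernel_quot[OF \<theta>])
  have "vimage_con ?h A (rho ar ?Q (Delta ?Q)) = rho ar A \<theta>"
    by (simp add: Delta flip: rho_vimage[OF epi Delta_in_Con[OF Q]])
  then have "complementary_over ar A (vimage_con ?h A (rho ar ?Q (Delta ?Q))) \<chi> \<chi>'"
    using compl by simp
  note image = complementary_over_image[OF this rho_in_Con[OF Q]]
  obtain \<gamma> where "\<gamma> \<in> BoolCon ar ?Q" and rho: "rho ar ?Q \<gamma> = rho ar ?Q (image_con ?h \<chi>)"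
    by (rule BoolCon_of_complementary_over_rho[OF Q Nabla_compact_codomain[OF Nabla_compact]
          ret image(1)])
  then obtain \<gamma>' where "complementary_over ar ?Q (Delta ?Q) \<gamma> \<gamma>'"
    by (auto simp: BoolCon_iff_complementary_over)
  then have \<gamma>: "\<gamma> \<in> Con ar ?Q"
    and "complementary_over ar A \<theta> (vimage_con ?h A \<gamma>) (vimage_con ?h A \<gamma>')"
    using complementary_over_vimage_iff[of \<gamma> \<gamma>' "Delta ?Q"] Con_subset_Nabla[OF Delta_in_Con[OF Q]]
    by (simp_all add: Delta complementary_over_def)
  moreover have "image_con ?h \<chi> \<in> Con ar ?Q" using image(1) by (simp add: complementary_over_def)
  then have "rho ar A (vimage_con ?h A \<gamma>) = rho ar A \<chi>"
    using rho_vimage[OF epi \<gamma>] rho_vimage[OF epi, of "image_con ?h \<chi>"] rho image(2) by simp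
  ultimately show ?thesis using that by blast
qed

lemma CBLP_imp_CBLP_rho:
  assumes \<theta>: "\<theta> \<in> Con ar A" and ret: "ret_preserves_bool ar (quot A \<theta>)" and cblp: "CBLP ar A \<theta>"
  shows "CBLP ar A (rho ar A \<theta>)"
  unfolding CBLP_iff_complementary_over[OF algebra rho_in_Con[OF algebra]]
proof (intro allI impI)
  let ?\<rho> = "rho ar A \<theta>"
  fix \<chi> \<chi>' assume compl: "complementary_over ar A ?\<rho> \<chi> \<chi>'"
  then have \<chi>: "\<chi> \<in> Con ar A" "?\<rho> \<subseteq> \<chi>" by (auto simp: complementary_over_def)
  obtain \<psi> \<psi>' where compl_\<psi>: "complementary_over ar A \<theta> \<psi> \<psi>'" and same: "rho ar A \<psi> = rho ar A \<chi>"
    by (rule complementary_over_rho_lift[OF \<theta> ret compl])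
  then obtain \<alpha> where \<alpha>: "\<alpha> \<in> BoolCon ar A" "join ar A \<alpha> \<theta> = \<psi>"
    using cblp unfolding CBLP_iff_complementary_over[OF algebra \<theta>] by blast
  have \<psi>: "\<psi> \<in> Con ar A" using compl_\<psi> by (simp add: complementary_over_def)
  note \<alpha>C = BoolCon_in_Con[OF \<alpha>(1)] and \<rho> = rho_in_Con[OF algebra, of \<theta>]
  have J: "join ar A \<alpha> ?\<rho> \<in> Con ar A" by (rule join_in_Con[OF algebra])
  have "\<chi> \<subseteq> rho ar A \<chi>" by (rule subset_rho[OF \<chi>(1)])
  also have "\<dots> = rho ar A (join ar A \<alpha> ?\<rho>)"
    unfolding same[symmetric] \<alpha>(2)[symmetric] by (rule rho_join_rho[OF algebra \<alpha>C \<theta>, symmetric])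
  finally have "\<chi> \<subseteq> join ar A \<alpha> ?\<rho>"
    using complemented_subset_rho_iff[OF compl J join_ge2[OF \<alpha>C \<rho>]] by simp
  moreover have "\<psi> \<subseteq> \<chi>"
    using complemented_subset_rho_iff[OF compl_\<psi> \<chi>(1)] subset_rho[OF \<theta>] subset_rho[OF \<psi>] \<chi>(2) same
    by simp
  then have "join ar A \<alpha> ?\<rho> \<subseteq> \<chi>"
    using join_ge1[OF \<alpha>C \<theta>] \<alpha>(2) \<chi> by (intro join_least) auto
  ultimately show "\<exists>\<alpha>\<in>BoolCon ar A. join ar A \<alpha> ?\<rho> = \<chi>" using \<alpha>(1) by blast
qed

lemma CBLP_rho_imp_CBLP:
  assumes \<theta>: "\<theta> \<in> Con ar A" and cblp: "CBLP ar A (rho ar A \<theta>)"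
  shows "CBLP ar A \<theta>"
  unfolding CBLP_iff_complementary_over[OF algebra \<theta>]
proof (intro allI impI)
  let ?\<rho> = "rho ar A \<theta>"
  note \<rho> = rho_in_Con[OF algebra, of \<theta>]
  fix \<chi> \<chi>' assume compl: "complementary_over ar A \<theta> \<chi> \<chi>'"
  then have \<chi>: "\<chi> \<in> Con ar A" "\<theta> \<subseteq> \<chi>" by (auto simp: complementary_over_def)
  obtain \<alpha> where \<alpha>: "\<alpha> \<in> BoolCon ar A" "join ar A \<alpha> ?\<rho> = join ar A \<chi> ?\<rho>"
    using complementary_over_rho[OF algebra compl] cblp
    unfolding CBLP_iff_complementary_over[OF algebra \<rho>] by blast
  obtain \<alpha>' where compl_\<alpha>: "complementary_over ar A (Delta A) \<alpha> \<alpha>'"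
    using \<alpha>(1) by (auto simp: BoolCon_iff_complementary_over)
  note \<alpha>C = BoolCon_in_Con[OF \<alpha>(1)]
  have J: "join ar A \<alpha> \<theta> \<in> Con ar A" by (rule join_in_Con[OF algebra])
  have "rho ar A (join ar A \<alpha> \<theta>) = rho ar A (join ar A \<chi> \<theta>)"
    using rho_join_rho[OF algebra \<alpha>C \<theta>] rho_join_rho[OF algebra \<chi>(1) \<theta>] \<alpha>(2) by simp
  also have "join ar A \<chi> \<theta> = \<chi>"
    using join_ge1[OF \<chi>(1) \<theta>] join_least[OF \<chi>(1) order_refl \<chi>(2)] by blast
  finally have same: "rho ar A (join ar A \<alpha> \<theta>) = rho ar A \<chi>" .
  then have "\<chi> \<subseteq> join ar A \<alpha> \<theta>"
    using complemented_subset_rho_iff[OF compl J join_ge2[OF \<alpha>C \<theta>]] subset_rho[OF \<chi>(1)] by simp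
  moreover have "\<alpha> \<subseteq> rho ar A \<chi>"
    using join_ge1[OF \<alpha>C \<theta>] subset_rho[OF J] same by simp
  then have "\<alpha> \<subseteq> \<chi>"
    using complemented_subset_rho_iff[OF compl_\<alpha> \<chi>(1) Delta_subset_Con[OF \<chi>(1)]] by simp
  then have "join ar A \<alpha> \<theta> \<subseteq> \<chi>" by (intro join_least \<chi>)
  ultimately show "\<exists>\<alpha>\<in>BoolCon ar A. join ar A \<alpha> \<theta> = \<chi>" using \<alpha>(1) by blast
qed

end

section \<open>Copies of pair algebras on a given type\<close>

text \<open>The standing assumption covers algebras on the types \<open>'a\<close> and \<open>'a set\<close> only, so quotients of
subalgebras of \<open>A \<times> A\<close> have to be copied to \<open>'a set\<close>. The only one for which this can fail is
\<open>A \<times> A\<close> itself, if \<open>A\<close> has three elements.\<close>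

lemma square_le_power2: "n\<^sup>2 \<le> Suc (2 ^ n)"
proof -
  consider "n = 0" | "n = 1" | "n = 2" | "n = 3" | (large) "n \<ge> 4" by linarith
  then show ?thesis
  proof cases
    case large
    then have "n\<^sup>2 \<le> 2 ^ n"
    proof (induction n rule: dec_induct)
      case (step n)
      have "Suc (n + n) \<le> 4 * n" using step by simp
      also have "\<dots> \<le> n * n" using step by simp
      finally have "(Suc n)\<^sup>2 \<le> 2 * n\<^sup>2" unfolding power2_eq_square by simp
      with step show ?case by simp
    qed simp
    then show ?thesis by simp
  qed auto
qed

lemma proper_pair_set_embeds:
  fixes S :: "('a \<times> 'a) set"
  assumes "S \<noteq> UNIV"
  obtains e :: "'a \<times> 'a \<Rightarrow> 'a set" where "inj_on e S"
proof (cases "finite (UNIV :: 'a set)")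
  case True
  then have finite: "finite (UNIV :: ('a \<times> 'a) set)" "finite (UNIV :: 'a set set)"
    by (simp_all add: finite_prod Finite_Set.finite_set)
  have "card S < card (UNIV :: ('a \<times> 'a) set)"
    using assms finite by (intro psubset_card_mono) auto
  also have "\<dots> = (card (UNIV :: 'a set))\<^sup>2"
    by (simp add: card_cartesian_product power2_eq_square flip: UNIV_Times_UNIV)
  also have "\<dots> \<le> Suc (2 ^ card (UNIV :: 'a set))" by (rule square_le_power2)
  also have "2 ^ card (UNIV :: 'a set) = card (UNIV :: 'a set set)"
    using card_Pow[OF True] by simp
  finally have "card S \<le> card (UNIV :: 'a set set)" by simp
  then obtain e :: "'a \<times> 'a \<Rightarrow> 'a set" where "inj_on e S"
    using card_le_inj[OF finite_subset[OF subset_UNIV finite(1)] finite(2)] by blast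
  then show ?thesis by (rule that)
next
  case False
  then have "(card_of (UNIV \<times> UNIV :: ('a \<times> 'a) set), card_of (UNIV :: 'a set)) \<in> ordLeq"
    using card_of_Times_same_infinite ordIso_imp_ordLeq by blast
  then obtain g :: "'a \<times> 'a \<Rightarrow> 'a" where g: "inj_on g (UNIV \<times> UNIV)"
    unfolding card_of_ordLeq[symmetric] by (elim exE conjE)
  have "inj_on (\<lambda>p. {g p}) S"
    using inj_onD[OF g] by (intro inj_onI) auto
  then show ?thesis by (rule that)
qed

lemma equiv_pairs_embeds:
  fixes r :: "('a \<times> 'a) rel"
  assumes r: "equiv S r" and "r \<noteq> Id"
  obtains e :: "'a \<times> 'a \<Rightarrow> 'a set" where "\<And>p q. p \<in> S \<Longrightarrow> q \<in> S \<Longrightarrow> e p = e q \<longleftrightarrow> (p, q) \<in> r"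
proof -
  define rep where "rep p = (SOME q. (p, q) \<in> r)" for p
  have rep: "(p, rep p) \<in> r" if "p \<in> S" for p
    unfolding rep_def by (rule someI[of _ p]) (use r that in \<open>simp add: equiv_def refl_on_def\<close>)
  have rep_eq: "rep p = rep q \<longleftrightarrow> (p, q) \<in> r" if "p \<in> S" "q \<in> S" for p q
  proof
    assume "rep p = rep q"
    then show "(p, q) \<in> r" using rep[OF that(1)] rep[OF that(2)] r by (metis equivE symD transD)
  next
    assume "(p, q) \<in> r"
    then have "(p, x) \<in> r \<longleftrightarrow> (q, x) \<in> r" for x using r by (metis equivE symD transD)
    then show "rep p = rep q" by (simp add: rep_def)
  qed
  have "rep ` S \<noteq> UNIV"
  proof
    assume UNIV: "rep ` S = UNIV"
    have "rep ` S \<subseteq> S" using rep r unfolding equiv_def by blast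
    then have S: "p \<in> S" for p using UNIV by blast
    have "p = q" if "(p, q) \<in> r" for p q
    proof -
      obtain p' q' where "p = rep p'" "q = rep q'" using UNIV by (metis UNIV_I imageE)
      then show ?thesis using that rep[OF S] rep_eq[OF S S] r by (metis equivE symD transD)
    qed
    moreover have "(p, p) \<in> r" for p using r S by (simp add: equiv_def refl_on_def)
    ultimately show False using \<open>r \<noteq> Id\<close> by auto
  qed
  then obtain e :: "'a \<times> 'a \<Rightarrow> 'a set" where "inj_on e (rep ` S)" by (rule proper_pair_set_embeds)
  then show ?thesis using that[of "e \<circ> rep"] rep_eq by (simp add: inj_on_eq_iff)
qed

lemma quotient_copy_exists:
  fixes B :: "('a \<times> 'a, 'f) alg"
  assumes B: "algebra ar B" and \<theta>: "\<theta> \<in> Con ar B" and "\<theta> \<noteq> Id"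
  obtains C :: "('a set, 'f) alg" and h where "epimorphism ar B C h" "kernel h B = \<theta>"
proof -
  obtain h :: "'a \<times> 'a \<Rightarrow> 'a set"
    where h: "\<And>p q. p \<in> carrier B \<Longrightarrow> q \<in> carrier B \<Longrightarrow> h p = h q \<longleftrightarrow> (p, q) \<in> \<theta>"
    by (rule equiv_pairs_embeds[OF Con_equiv[OF \<theta>] \<open>\<theta> \<noteq> Id\<close>]) blast
  obtain C where "epimorphism ar B C h" by (rule epimorphism_exists[OF B \<theta> h])
  moreover have "kernel h B = \<theta>" using h Con_carrier[OF \<theta>] by (auto simp: in_vimage_con)
  ultimately show ?thesis by (rule that)
qed

lemma modular_pair_algI:
  fixes A :: "('a, 'f) alg"
  assumes A: "algebra ar A" and \<beta>: "\<beta> \<in> Con ar A" "\<beta> \<noteq> Nabla A"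
    and copies: "\<And>(C :: ('a set, 'f) alg) h. epimorphism ar (pair_alg A \<beta>) C h \<Longrightarrow> modular_Con ar C"
  shows "modular_Con ar (pair_alg A \<beta>)"
proof -
  note P = pair_alg_algebra[OF A \<beta>(1)]
  have "\<beta> \<noteq> UNIV" using \<beta>(2) Con_subset_Nabla[OF \<beta>(1)] by blast
  then have "Delta (pair_alg A \<beta>) \<noteq> Id" by (auto simp: Delta_def)
  then obtain C :: "('a set, 'f) alg" and h
    where "epimorphism ar (pair_alg A \<beta>) C h" "kernel h (pair_alg A \<beta>) = Delta (pair_alg A \<beta>)"
    by (rule quotient_copy_exists[OF P Delta_in_Con[OF P]])
  then show ?thesis using epimorphism.modular_Con_domain copies by metis
qed

lemma diag_con_NablaI:
  fixes A :: "('a, 'f) alg"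
  assumes A: "algebra ar A" and \<beta>: "\<beta> \<in> Con ar A"
    and copies: "\<And>(C :: ('a set, 'f) alg) h.
      epimorphism ar (pair_alg A \<beta>) C h \<Longrightarrow> no_trivial_subalg ar C"
  shows "diag_con ar A \<beta> (Nabla A) = Nabla (pair_alg A \<beta>)" (is "?D = _")
proof -
  note P = pair_alg_algebra[OF A \<beta>] and D = diag_con_in_Con[OF A \<beta>, of "Nabla A"]
  note diagonal = diagonal_in_diag_con[OF \<beta> Nabla_in_Con[OF A]]
  obtain x where x: "x \<in> carrier A" using A by (auto simp: algebra_def)
  show ?thesis
  proof (cases "?D = Id")
    case True
    then have "y = x" if "y \<in> carrier A" for y
      using diagonal[of y x] that x by (simp add: Nabla_def)
    then have "p = (x, x)" if "p \<in> \<beta>" for p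
      using that Con_carrier[OF \<beta>] by (cases p) blast
    then have "p = q" if "p \<in> \<beta>" "q \<in> \<beta>" for p q using that by metis
    then have "Nabla (pair_alg A \<beta>) \<subseteq> Id" by (auto simp: Nabla_def)
    then have "Nabla (pair_alg A \<beta>) \<subseteq> ?D" by (simp only: True)
    then show ?thesis using Con_subset_Nabla[OF D] by blast
  next
    case False
    obtain C :: "('a set, 'f) alg" and h
      where epi: "epimorphism ar (pair_alg A \<beta>) C h" and ker: "kernel h (pair_alg A \<beta>) = ?D"
      by (rule quotient_copy_exists[OF P D False])
    have "(ops A f (replicate (ar f) x), x) \<in> Nabla A" for f
      using x by (auto simp: Nabla_def intro!: algebra_ops[OF A])
    then have "(ops (pair_alg A \<beta>) f (replicate (ar f) (x, x)), (x, x)) \<in> ?D" for f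
      using diagonal by simp
    then show ?thesis
      using epimorphism.kernel_eq_NablaI[OF epi copies[OF epi], of "(x, x)"] Con_refl[OF \<beta> x]
      by (simp add: ker)
  qed
qed

text \<open>Identifying an element \<open>x\<close> with all \<open>f(x, \<dots>, x)\<close>, finitely many conditions, creates a
one-element subalgebra.\<close>

lemma Nabla_compactI:
  fixes A :: "('a, 'f) alg"
  assumes "finite (UNIV :: 'f set)" and A: "algebra ar A"
    and quotients: "\<And>\<theta>. \<theta> \<in> Con ar A \<Longrightarrow> no_trivial_subalg ar (quot A \<theta>)"
  shows "Nabla A \<in> K ar A"
proof -
  obtain x where x: "x \<in> carrier A" using A by (auto simp: algebra_def)
  let ?R = "range (\<lambda>f. (ops A f (replicate (ar f) x), x))"
  have R: "finite ?R" "?R \<subseteq> Nabla A"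
    using assms(1) x by (auto simp: Nabla_def intro!: algebra_ops[OF A])
  have \<theta>: "Cg ar A ?R \<in> Con ar A" by (rule Cg_in_Con[OF A])
  have "(ops A f (replicate (ar f) x), x) \<in> Cg ar A ?R" for f
    using subset_Cg[OF R(2)] by blast
  then have "Cg ar A ?R = Nabla A"
    using epimorphism.kernel_eq_NablaI[OF epimorphism_quot[OF A \<theta>] quotients[OF \<theta>] x]
    by (simp add: kernel_quot[OF \<theta>])
  then show ?thesis using Cg_finite_compact[OF A R] by simp
qed

lemma (in epimorphism) standing_codomain:
  assumes "\<forall>(s, t)\<in>Eqs. wf_term ar s \<and> wf_term ar t" and "inV ar Eqs B" and "standing ar Eqs C"
  shows "modular_Con ar C" "no_trivial_subalg ar C" "ret_preserves_bool ar C"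
  using inV_codomain[OF assms(1,2)] assms(3) by (simp_all add: standing_def)

lemma modular_semidegenerate_algebraI:
  fixes A :: "('a, 'f) alg"
  assumes "finite (UNIV :: 'f set)" and wf: "\<forall>(s, t)\<in>Eqs. wf_term ar s \<and> wf_term ar t"
    and standing: "\<forall>C :: ('a set, 'f) alg. standing ar Eqs C" and A: "inV ar Eqs A"
  shows "modular_semidegenerate_algebra ar A"
proof
  note standing_image = epimorphism.standing_codomain[OF _ wf _ standing[rule_format]]
  show alg: "algebra ar A" using A by (simp add: inV_def)
  show "Nabla A \<in> K ar A"
    by (rule Nabla_compactI[OF assms(1) alg standing_image(2)[OF epimorphism_quot[OF alg] A]])
  show "modular_Con ar (pair_alg A \<beta>)" if "\<beta> \<in> Con ar A" "\<beta> \<noteq> Nabla A" for \<beta>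
    by (rule modular_pair_algI[OF alg that standing_image(1)[OF _ pair_alg_inV[OF A that(1)]]])
  show "diag_con ar A \<beta> (Nabla A) = Nabla (pair_alg A \<beta>)" if "\<beta> \<in> Con ar A" for \<beta>
    by (rule diag_con_NablaI[OF alg that standing_image(2)[OF _ pair_alg_inV[OF A that]]])
qed

theorem theorem5p4:
  fixes ar :: "'f \<Rightarrow> nat"
    and Eqs :: "(('f, nat) term \<times> ('f, nat) term) set"
    and A :: "('a, 'f) alg"
    and \<theta> :: "('a \<times> 'a) set"
  assumes finite_sig: "finite (UNIV :: 'f set)"
    and wf_Eqs: "\<forall>(s, t)\<in>Eqs. wf_term ar s \<and> wf_term ar t"
    and standing_a: "\<forall>B :: ('a, 'f) alg. standing ar Eqs B"
    and standing_aset: "\<forall>B :: ('a set, 'f) alg. standing ar Eqs B"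
    and A_in_V: "inV ar Eqs A"
    and theta_Con: "\<theta> \<in> Con ar A"
  shows "CBLP ar A \<theta> \<longleftrightarrow> CBLP ar A (rho ar A \<theta>)"
proof -
  interpret modular_semidegenerate_algebra ar A
    by (rule modular_semidegenerate_algebraI[OF finite_sig wf_Eqs standing_aset A_in_V])
  have "ret_preserves_bool ar (quot A \<theta>)"
    by (rule epimorphism.standing_codomain(3)[OF epimorphism_quot[OF algebra theta_Con]
          wf_Eqs A_in_V standing_aset[rule_format]])
  then show ?thesis using CBLP_imp_CBLP_rho CBLP_rho_imp_CBLP theta_Con by blast
qed

end
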